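(* Let $\Lambda$ be an Artin algebra and let $P$ be an indecomposable projective $\Lambda$-module. Then there is an exact sequence in $\mathrm{mod}\text{-}\Lambda$ $$0\to\Omega^2_\Lambda(\nu P)\to\Omega^2_\Lambda(\nu P/\mathrm{soc}(\nu P))\oplus Q\to P\xrightarrow{\alpha_P}\nu P\to\nu P/\mathrm{soc}(\nu P)\to 0,$$ where $Q$ is a projective $\Lambda$-module.
   Context: $\mathrm{mod}\text{-}\Lambda$ is the category of finitely generated $\Lambda$-modules. $\Omega_\Lambda(M)$ denotes the syzygy of $M$ (the kernel of a projective cover), $\Omega^2_\Lambda=\Omega_\Lambda\circ\Omega_\Lambda$, and $\nu=D\,\mathrm{Hom}_\Lambda(-,\Lambda)$ is the Nakayama functor. For an indecomposable projective module $P$, $\alpha_P:P\to\nu P$ denotes the composite $P\xrightarrow{p}\mathrm{top}(P)\simeq\mathrm{soc}(\nu P)\xrightarrow{i}\nu P$ of the canonical epimorphism, an isomorphism, and the canonical inclusion (it is unique up to isomorphism as an object of the morphism category of $\mathrm{mod}\text{-}\Lambda$). *)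

theory Defs
  imports "HOL-Algebra.Algebra"
begin

text \<open>
  The library locale \<open>module\<close> is restricted to commutative rings of scalars. Modules over an
  arbitrary ring are therefore left modules in the sense below, on the same \<open>module\<close> records
  (whose \<open>mult\<close> and \<open>one\<close> fields are irrelevant). Right modules over a ring are
  left modules over the opposite ring, and \<open>mod-\<Lambda>\<close> is read as finitely generated left modules.
\<close>

locale left_module = R?: ring R + M?: abelian_group M
  for R :: "('a, 'r) ring_scheme" (structure) and M :: "('a, 'm, 'x) module_scheme" (structure) +
  assumes smult_closed:
      "\<lbrakk>a \<in> carrier R; x \<in> carrier M\<rbrakk> \<Longrightarrow> a \<odot>\<^bsub>M\<^esub> x \<in> carrier M"
    and smult_l_distr:
      "\<lbrakk>a \<in> carrier R; b \<in> carrier R; x \<in> carrier M\<rbrakk> \<Longrightarrow>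
        (a \<oplus> b) \<odot>\<^bsub>M\<^esub> x = a \<odot>\<^bsub>M\<^esub> x \<oplus>\<^bsub>M\<^esub> b \<odot>\<^bsub>M\<^esub> x"
    and smult_r_distr:
      "\<lbrakk>a \<in> carrier R; x \<in> carrier M; y \<in> carrier M\<rbrakk> \<Longrightarrow>
        a \<odot>\<^bsub>M\<^esub> (x \<oplus>\<^bsub>M\<^esub> y) = a \<odot>\<^bsub>M\<^esub> x \<oplus>\<^bsub>M\<^esub> a \<odot>\<^bsub>M\<^esub> y"
    and smult_assoc1:
      "\<lbrakk>a \<in> carrier R; b \<in> carrier R; x \<in> carrier M\<rbrakk> \<Longrightarrow>
        (a \<otimes> b) \<odot>\<^bsub>M\<^esub> x = a \<odot>\<^bsub>M\<^esub> (b \<odot>\<^bsub>M\<^esub> x)"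
    and smult_one: "x \<in> carrier M \<Longrightarrow> \<one> \<odot>\<^bsub>M\<^esub> x = x"

definition lspan :: "('a, 'r) ring_scheme \<Rightarrow> ('a, 'm, 'x) module_scheme \<Rightarrow> 'm set \<Rightarrow> 'm set"
  where "lspan R M S = \<Inter>{N. submodule N R M \<and> S \<subseteq> N}"

definition fin_gen :: "('a, 'r) ring_scheme \<Rightarrow> ('a, 'm, 'x) module_scheme \<Rightarrow> bool"
  where "fin_gen R M \<longleftrightarrow> (\<exists>S. finite S \<and> S \<subseteq> carrier M \<and> lspan R M S = carrier M)"

definition fg_module :: "('a, 'r) ring_scheme \<Rightarrow> ('a, 'm) module \<Rightarrow> bool"
  where "fg_module R M \<longleftrightarrow> left_module R M \<and> fin_gen R M"

definition lhom :: "('a, 'r) ring_scheme \<Rightarrow> ('a, 'm) module \<Rightarrow> ('a, 'n) module \<Rightarrow> ('m \<Rightarrow> 'n) set"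
  where "lhom R M N = {f \<in> carrier M \<rightarrow> carrier N.
    (\<forall>x\<in>carrier M. \<forall>y\<in>carrier M. f (x \<oplus>\<^bsub>M\<^esub> y) = f x \<oplus>\<^bsub>N\<^esub> f y) \<and>
    (\<forall>a\<in>carrier R. \<forall>x\<in>carrier M. f (a \<odot>\<^bsub>M\<^esub> x) = a \<odot>\<^bsub>N\<^esub> f x)}"

definition liso :: "('a, 'r) ring_scheme \<Rightarrow> ('a, 'm) module \<Rightarrow> ('a, 'n) module \<Rightarrow> ('m \<Rightarrow> 'n) set"
  where "liso R M N = {f \<in> lhom R M N. bij_betw f (carrier M) (carrier N)}"

definition regular :: "('a, 'r) ring_scheme \<Rightarrow> ('a, 'a) module"
  where "regular R = \<lparr>carrier = carrier R, monoid.mult = monoid.mult R, monoid.one = monoid.one R,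
    ring.zero = ring.zero R, ring.add = ring.add R, module.smult = monoid.mult R\<rparr>"

definition sub_mod :: "('a, 'm) module \<Rightarrow> 'm set \<Rightarrow> ('a, 'm) module"
  where "sub_mod M N = M\<lparr>carrier := N\<rparr>"

definition ker_mod :: "('a, 'm) module \<Rightarrow> ('a, 'n) module \<Rightarrow> ('m \<Rightarrow> 'n) \<Rightarrow> ('a, 'm) module"
  where "ker_mod M N f = sub_mod M (a_kernel M N f)"

definition quot_mod :: "('a, 'm) module \<Rightarrow> 'm set \<Rightarrow> ('a, 'm set) module"
  where "quot_mod M N = \<lparr>carrier = a_rcosets\<^bsub>M\<^esub> N, monoid.mult = undefined, monoid.one = undefined,
    ring.zero = N, ring.add = set_add M, module.smult = (\<lambda>a U. \<Union>x\<in>U. N +>\<^bsub>M\<^esub> (a \<odot>\<^bsub>M\<^esub> x))\<rparr>"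

definition mod_sum :: "('a, 'm) module \<Rightarrow> ('a, 'n) module \<Rightarrow> ('a, 'm \<times> 'n) module"
  where "mod_sum M N = \<lparr>carrier = carrier M \<times> carrier N,
    monoid.mult = undefined, monoid.one = undefined, ring.zero = (\<zero>\<^bsub>M\<^esub>, \<zero>\<^bsub>N\<^esub>),
    ring.add = (\<lambda>(x, y) (x', y'). (x \<oplus>\<^bsub>M\<^esub> x', y \<oplus>\<^bsub>N\<^esub> y')),
    module.smult = (\<lambda>a (x, y). (a \<odot>\<^bsub>M\<^esub> x, a \<odot>\<^bsub>N\<^esub> y))\<rparr>"

definition simple_submodule :: "('a, 'r) ring_scheme \<Rightarrow> ('a, 'm) module \<Rightarrow> 'm set \<Rightarrow> bool"
  where "simple_submodule R M N \<longleftrightarrow> submodule N R M \<and> N \<noteq> {\<zero>\<^bsub>M\<^esub>} \<and>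
    (\<forall>U. submodule U R M \<and> U \<subseteq> N \<longrightarrow> U = {\<zero>\<^bsub>M\<^esub>} \<or> U = N)"

definition maximal_submodule :: "('a, 'r) ring_scheme \<Rightarrow> ('a, 'm) module \<Rightarrow> 'm set \<Rightarrow> bool"
  where "maximal_submodule R M N \<longleftrightarrow> submodule N R M \<and> N \<noteq> carrier M \<and>
    (\<forall>U. submodule U R M \<and> N \<subseteq> U \<longrightarrow> U = N \<or> U = carrier M)"

definition soc :: "('a, 'r) ring_scheme \<Rightarrow> ('a, 'm) module \<Rightarrow> 'm set"
  where "soc R M = lspan R M (\<Union>{N. simple_submodule R M N})"

definition mrad :: "('a, 'r) ring_scheme \<Rightarrow> ('a, 'm) module \<Rightarrow> 'm set"
  where "mrad R M = carrier M \<inter> \<Inter>{N. maximal_submodule R M N}"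

definition top_mod :: "('a, 'r) ring_scheme \<Rightarrow> ('a, 'm) module \<Rightarrow> ('a, 'm set) module"
  where "top_mod R M = quot_mod M (mrad R M)"

definition indecomposable_module :: "('a, 'r) ring_scheme \<Rightarrow> ('a, 'm) module \<Rightarrow> bool"
  where "indecomposable_module R M \<longleftrightarrow> left_module R M \<and> carrier M \<noteq> {\<zero>\<^bsub>M\<^esub>} \<and>
    (\<forall>A B. submodule A R M \<and> submodule B R M \<and> A \<inter> B = {\<zero>\<^bsub>M\<^esub>} \<and> set_add M A B = carrier M
      \<longrightarrow> A = {\<zero>\<^bsub>M\<^esub>} \<or> B = {\<zero>\<^bsub>M\<^esub>})"

text \<open>
  A definition cannot quantify over all types, so the lifting property is tested on epimorphisms
  \<open>A \<rightarrow> B\<close> with \<open>A\<close> of type \<open>'p \<Rightarrow> 'a\<close> and \<open>B\<close> of type \<open>'p\<close>. This loses nothing: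
  the free module on the set \<open>carrier P\<close> (finitely supported functions) lives on \<open>'p \<Rightarrow> 'a\<close>,
  and lifting the identity of \<open>P\<close> along its canonical epimorphism onto \<open>P\<close> makes \<open>P\<close> a direct
  summand of a free module.
\<close>

definition projective_module :: "('a, 'r) ring_scheme \<Rightarrow> ('a, 'p) module \<Rightarrow> bool"
  where "projective_module R P \<longleftrightarrow> left_module R P \<and>
    (\<forall>(A :: ('a, 'p \<Rightarrow> 'a) module) (B :: ('a, 'p) module) g f.
      left_module R A \<and> left_module R B \<and> g \<in> lhom R A B \<and> g ` carrier A = carrier B \<and>
      f \<in> lhom R P B \<longrightarrow> (\<exists>h\<in>lhom R P A. \<forall>x\<in>carrier P. g (h x) = f x))"

text \<open>
  Similarly, the extension property is tested on monomorphisms between modules on the type of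
  the ring; these include the inclusions of left ideals, so by Baer's criterion this is
  injectivity.
\<close>

definition injective_module :: "('a, 'r) ring_scheme \<Rightarrow> ('a, 'e) module \<Rightarrow> bool"
  where "injective_module R E \<longleftrightarrow> left_module R E \<and>
    (\<forall>(A :: ('a, 'a) module) (B :: ('a, 'a) module) i f.
      left_module R A \<and> left_module R B \<and> i \<in> lhom R A B \<and> inj_on i (carrier A) \<and>
      f \<in> lhom R A E \<longrightarrow> (\<exists>h\<in>lhom R B E. \<forall>x\<in>carrier A. h (i x) = f x))"

definition injective_envelope ::
    "('a, 'r) ring_scheme \<Rightarrow> ('a, 'm) module \<Rightarrow> ('a, 'e) module \<Rightarrow> ('m \<Rightarrow> 'e) \<Rightarrow> bool"
  where "injective_envelope R M E i \<longleftrightarrow>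
    left_module R M \<and> injective_module R E \<and> i \<in> lhom R M E \<and> inj_on i (carrier M) \<and>
    (\<forall>U. submodule U R E \<and> U \<inter> i ` carrier M = {\<zero>\<^bsub>E\<^esub>} \<longrightarrow> U = {\<zero>\<^bsub>E\<^esub>})"

text \<open>Projective covers in the category of finitely generated modules.\<close>

definition projective_cover ::
    "('a, 'r) ring_scheme \<Rightarrow> ('a, 'p) module \<Rightarrow> ('p \<Rightarrow> 'm) \<Rightarrow> ('a, 'm) module \<Rightarrow> bool"
  where "projective_cover R P p M \<longleftrightarrow>
    fg_module R P \<and> projective_module R P \<and> fg_module R M \<and>
    p \<in> lhom R P M \<and> p ` carrier P = carrier M \<and>
    (\<forall>U. submodule U R P \<and> set_add P U (a_kernel P M p) = carrier P \<longrightarrow> U = carrier P)"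

definition artinian_ring :: "('a, 'r) ring_scheme \<Rightarrow> bool"
  where "artinian_ring R \<longleftrightarrow> ring R \<and>
    (\<forall>I :: nat \<Rightarrow> 'a set. (\<forall>n. submodule (I n) R (regular R) \<and> I (Suc n) \<subseteq> I n)
      \<longrightarrow> (\<exists>m. \<forall>n\<ge>m. I n = I m))"

locale artin_algebra = module k \<Lambda> + ring \<Lambda>
  for k :: "('k, 'r) ring_scheme" (structure) and \<Lambda> :: "('k, 'a, 'x) module_scheme" (structure) +
  assumes smult_mult_l:
      "\<lbrakk>c \<in> carrier k; x \<in> carrier \<Lambda>; y \<in> carrier \<Lambda>\<rbrakk> \<Longrightarrow>
        (c \<odot>\<^bsub>\<Lambda>\<^esub> x) \<otimes>\<^bsub>\<Lambda>\<^esub> y = c \<odot>\<^bsub>\<Lambda>\<^esub> (x \<otimes>\<^bsub>\<Lambda>\<^esub> y)"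
    and smult_mult_r:
      "\<lbrakk>c \<in> carrier k; x \<in> carrier \<Lambda>; y \<in> carrier \<Lambda>\<rbrakk> \<Longrightarrow>
        x \<otimes>\<^bsub>\<Lambda>\<^esub> (c \<odot>\<^bsub>\<Lambda>\<^esub> y) = c \<odot>\<^bsub>\<Lambda>\<^esub> (x \<otimes>\<^bsub>\<Lambda>\<^esub> y)"
    and artinian: "artinian_ring k"
    and fin_gen: "fin_gen k \<Lambda>"

definition op_ring :: "('a, 'r) ring_scheme \<Rightarrow> ('a, 'r) ring_scheme"
  where "op_ring R = R\<lparr>monoid.mult := \<lambda>x y. y \<otimes>\<^bsub>R\<^esub> x\<rparr>"

definition restrict_scalars :: "('k, 'a) module \<Rightarrow> ('a, 'm) module \<Rightarrow> ('k, 'm) module"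
  where "restrict_scalars A M = \<lparr>carrier = carrier M, monoid.mult = monoid.mult M, monoid.one = monoid.one M,
    ring.zero = ring.zero M, ring.add = ring.add M, module.smult = (\<lambda>c x. (c \<odot>\<^bsub>A\<^esub> \<one>\<^bsub>A\<^esub>) \<odot>\<^bsub>M\<^esub> x)\<rparr>"

text \<open>
  For a left \<open>R\<close>-module \<open>M\<close>, the right \<open>R\<close>-module \<open>Hom\<^sub>R(M, R)\<close> with
  \<open>(f a)(x) = f(x) a\<close>, as a left module over \<open>op_ring R\<close>. Elements of Hom modules are
  extensional functions, so that equality is equality on the carrier.
\<close>

definition hom_to_ring :: "('a, 'r) ring_scheme \<Rightarrow> ('a, 'm) module \<Rightarrow> ('a, 'm \<Rightarrow> 'a) module"
  where "hom_to_ring R M = \<lparr>carrier = lhom R M (regular R) \<inter> extensional (carrier M),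
    monoid.mult = undefined, monoid.one = undefined, ring.zero = (\<lambda>x\<in>carrier M. \<zero>\<^bsub>R\<^esub>),
    ring.add = (\<lambda>f g. \<lambda>x\<in>carrier M. f x \<oplus>\<^bsub>R\<^esub> g x),
    module.smult = (\<lambda>a f. \<lambda>x\<in>carrier M. f x \<otimes>\<^bsub>R\<^esub> a)\<rparr>"

text \<open>
  For a left module \<open>M\<close> over a \<open>k\<close>-algebra \<open>A\<close>, the right \<open>A\<close>-module
  \<open>D M = Hom\<^sub>k(M, E)\<close> with \<open>(h a)(x) = h(a x)\<close>, as a left module over \<open>op_ring A\<close>.
  It is the standard duality of an Artin \<open>k\<close>-algebra when \<open>E\<close> is the injective envelope of
  \<open>k/rad k\<close>, that is, of \<open>top_mod k (regular k)\<close>.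
\<close>

definition duality ::
    "('k, 'r) ring_scheme \<Rightarrow> ('k, 'e) module \<Rightarrow> ('k, 'a) module \<Rightarrow> ('a, 'm) module
      \<Rightarrow> ('a, 'm \<Rightarrow> 'e) module"
  where "duality k E A M =
    \<lparr>carrier = lhom k (restrict_scalars A M) E \<inter> extensional (carrier M),
    monoid.mult = undefined, monoid.one = undefined, ring.zero = (\<lambda>x\<in>carrier M. \<zero>\<^bsub>E\<^esub>),
    ring.add = (\<lambda>f g. \<lambda>x\<in>carrier M. f x \<oplus>\<^bsub>E\<^esub> g x),
    module.smult = (\<lambda>a h. \<lambda>x\<in>carrier M. h (a \<odot>\<^bsub>M\<^esub> x))\<rparr>"

text \<open>
  \<open>\<nu> = D Hom\<^sub>\<Lambda>(-, \<Lambda>)\<close>; the result is a left module over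
  \<open>op_ring (op_ring \<Lambda>) = \<Lambda>\<close>.
\<close>

definition nakayama ::
    "('k, 'r) ring_scheme \<Rightarrow> ('k, 'e) module \<Rightarrow> ('k, 'a) module \<Rightarrow> ('a, 'm) module
      \<Rightarrow> ('a, ('m \<Rightarrow> 'a) \<Rightarrow> 'e) module"
  where "nakayama k E \<Lambda> M = duality k E (op_ring \<Lambda>) (hom_to_ring \<Lambda> M)"

text \<open>
  \<open>\<phi>\<close> is meant to be an isomorphism \<open>top P \<rightarrow> soc (\<nu> P)\<close>; the inclusion of the socle into
  \<open>\<nu> P\<close> is the identity on elements.
\<close>

definition alpha_map :: "('a, 'r) ring_scheme \<Rightarrow> ('a, 'p) module \<Rightarrow> ('p set \<Rightarrow> 'n) \<Rightarrow> 'p \<Rightarrow> 'n"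
  where "alpha_map R P \<phi> = (\<lambda>x. \<phi> (mrad R P +>\<^bsub>P\<^esub> x))"

text \<open>
  Exactness of \<open>0 \<rightarrow> X1 \<rightarrow> X2 \<rightarrow> X3 \<rightarrow> X4 \<rightarrow> X5 \<rightarrow> 0\<close> in the category of finitely generated
  modules.
\<close>

definition exact_in_mod ::
    "('a, 'r) ring_scheme \<Rightarrow> ('a, 'm1) module \<Rightarrow> ('m1 \<Rightarrow> 'm2) \<Rightarrow> ('a, 'm2) module
      \<Rightarrow> ('m2 \<Rightarrow> 'm3) \<Rightarrow> ('a, 'm3) module \<Rightarrow> ('m3 \<Rightarrow> 'm4) \<Rightarrow> ('a, 'm4) module
      \<Rightarrow> ('m4 \<Rightarrow> 'm5) \<Rightarrow> ('a, 'm5) module \<Rightarrow> bool"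
  where "exact_in_mod R X1 f1 X2 f2 X3 f3 X4 f4 X5 \<longleftrightarrow>
    fg_module R X1 \<and> fg_module R X2 \<and> fg_module R X3 \<and> fg_module R X4 \<and> fg_module R X5 \<and>
    f1 \<in> lhom R X1 X2 \<and> f2 \<in> lhom R X2 X3 \<and> f3 \<in> lhom R X3 X4 \<and> f4 \<in> lhom R X4 X5 \<and>
    inj_on f1 (carrier X1) \<and>
    f1 ` carrier X1 = a_kernel X2 X3 f2 \<and>
    f2 ` carrier X2 = a_kernel X3 X4 f3 \<and>
    f3 ` carrier X3 = a_kernel X4 X5 f4 \<and>
    f4 ` carrier X4 = carrier X5"

end

theory Submission
  imports Defs
begin

text \<open>
  Let \<open>A0\<close> and \<open>A1\<close> be the projective covers of \<open>\<nu>P\<close> and \<open>\<Omega>(\<nu>P)\<close>, and let \<open>L\<close> be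
  the kernel of the epimorphism from \<open>A0\<close> to \<open>C = \<nu>P/soc(\<nu>P)\<close>. Lifting \<open>\<alpha>\<close> to
  \<open>t : P \<rightarrow> A0\<close> gives an epimorphism \<open>A1 \<oplus> P \<rightarrow> L\<close>; let \<open>W\<close> be its kernel. The
  projection \<open>W \<rightarrow> P\<close> has kernel \<open>\<Omega>\<^sup>2(\<nu>P)\<close> and image \<open>ker \<alpha>\<close>. By Schanuel's lemma
  \<open>W\<close> is also \<open>\<Omega>\<^sup>2(C) \<oplus> Q\<close> with \<open>Q\<close> projective, since \<open>L\<close> is the sum of
  \<open>\<Omega>(C)\<close> and a projective module. The syzygies are finitely generated because \<open>\<Lambda>\<close> is
  finitely generated over an Artinian commutative ring, hence Noetherian.
\<close>

subsection \<open>Left modules\<close>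

text \<open>Minimality of the cover B0 \<rightarrow> C makes B0 a direct summand of A0, compatibly
  with the maps to C. Its complement Z is projective and lies in L because it maps to zero in C, so
  L is the direct sum of Z and a copy of \<Omega>(C). Being projective, Z also splits off from A1
  \<oplus> P; the remaining summand G' is projective, maps onto \<Omega>(C) and still has kernel W.
  The map G' \<rightarrow> \<Omega>(C) need not be minimal, and Q is the complement of its
  projective cover B1 in G'. Two restrictions on types shape the statements. Projectivity is tested
  on modules over two fixed types, so lifting along arbitrary epimorphisms has to be recovered
  through a free module. The existentially quantified Q needs a type fixed in advance, so it is
  moved into some \<Lambda>^n, whose elements are functions on the natural numbers.\<close>

context left_module
begin

lemma smult_zero_right [simp]:
  assumes "a \<in> carrier R" shows "a \<odot>\<^bsub>M\<^esub> \<zero>\<^bsub>M\<^esub> = \<zero>\<^bsub>M\<^esub>"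
proof -
  have "a \<odot>\<^bsub>M\<^esub> \<zero>\<^bsub>M\<^esub> \<oplus>\<^bsub>M\<^esub> a \<odot>\<^bsub>M\<^esub> \<zero>\<^bsub>M\<^esub> = a \<odot>\<^bsub>M\<^esub> \<zero>\<^bsub>M\<^esub>"
    using smult_r_distr[of a "\<zero>\<^bsub>M\<^esub>" "\<zero>\<^bsub>M\<^esub>"] assms by simp
  then show ?thesis
    using assms smult_closed by (metis M.add.r_cancel_one' M.zero_closed)
qed

lemma smult_zero_left [simp]:
  assumes "x \<in> carrier M" shows "\<zero> \<odot>\<^bsub>M\<^esub> x = \<zero>\<^bsub>M\<^esub>"
proof -
  have "\<zero> \<odot>\<^bsub>M\<^esub> x \<oplus>\<^bsub>M\<^esub> \<zero> \<odot>\<^bsub>M\<^esub> x = \<zero> \<odot>\<^bsub>M\<^esub> x"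
    using smult_l_distr[of \<zero> \<zero> x] assms by simp
  then show ?thesis
    using assms smult_closed by (metis M.add.r_cancel_one' R.zero_closed)
qed

lemma neg_eq_smult:
  assumes "x \<in> carrier M" shows "\<ominus>\<^bsub>M\<^esub> x = (\<ominus> \<one>) \<odot>\<^bsub>M\<^esub> x"
proof -
  have "(\<ominus> \<one>) \<odot>\<^bsub>M\<^esub> x \<oplus>\<^bsub>M\<^esub> x = (\<ominus> \<one> \<oplus> \<one>) \<odot>\<^bsub>M\<^esub> x"
    using assms by (simp add: smult_l_distr smult_one)
  then have "(\<ominus> \<one>) \<odot>\<^bsub>M\<^esub> x \<oplus>\<^bsub>M\<^esub> x = \<zero>\<^bsub>M\<^esub>"
    using assms by (simp add: R.l_neg)
  then show ?thesis
    using assms smult_closed by (simp add: M.minus_equality)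
qed

lemma add_minus_cancel:
  assumes "x \<in> carrier M" "y \<in> carrier M"
  shows "y \<oplus>\<^bsub>M\<^esub> (x \<ominus>\<^bsub>M\<^esub> y) = x" and "(x \<ominus>\<^bsub>M\<^esub> y) \<oplus>\<^bsub>M\<^esub> y = x"
    and "(x \<oplus>\<^bsub>M\<^esub> y) \<ominus>\<^bsub>M\<^esub> y = x" and "(y \<oplus>\<^bsub>M\<^esub> x) \<ominus>\<^bsub>M\<^esub> y = x"
  using assms
  by (simp_all add: M.minus_eq M.a_ac M.r_neg M.r_neg1 M.r_neg2)

lemma minus_self:
  "x \<in> carrier M \<Longrightarrow> x \<ominus>\<^bsub>M\<^esub> x = \<zero>\<^bsub>M\<^esub>"
  by (simp add: M.minus_eq M.r_neg)

text \<open>Negatives come from the scalar \<open>\<ominus> \<one>\<close>, so closure under them is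
  no separate premise, although \<open>submodule\<close> is built on subgroups of the additive
  group.\<close>

lemma submodI:
  assumes "N \<subseteq> carrier M" "\<zero>\<^bsub>M\<^esub> \<in> N"
    and "\<And>x y. x \<in> N \<Longrightarrow> y \<in> N \<Longrightarrow> x \<oplus>\<^bsub>M\<^esub> y \<in> N"
    and smult: "\<And>a x. a \<in> carrier R \<Longrightarrow> x \<in> N \<Longrightarrow> a \<odot>\<^bsub>M\<^esub> x \<in> N"
  shows "submodule N R M"
proof -
  have "\<ominus>\<^bsub>M\<^esub> x \<in> N" if "x \<in> N" for x
    using smult[of "\<ominus> \<one>" x] that assms(1) by (auto simp: neg_eq_smult)
  then show ?thesis
    using assms by (intro submodule.intro subgroup.intro submodule_axioms.intro)
      (auto simp flip: a_inv_def)
qed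

lemma submodD:
  assumes "submodule N R M"
  shows "N \<subseteq> carrier M" "\<zero>\<^bsub>M\<^esub> \<in> N"
    and "\<And>x y. x \<in> N \<Longrightarrow> y \<in> N \<Longrightarrow> x \<oplus>\<^bsub>M\<^esub> y \<in> N"
    and "\<And>a x. a \<in> carrier R \<Longrightarrow> x \<in> N \<Longrightarrow> a \<odot>\<^bsub>M\<^esub> x \<in> N"
    and "\<And>x. x \<in> N \<Longrightarrow> \<ominus>\<^bsub>M\<^esub> x \<in> N"
    and "\<And>x y. x \<in> N \<Longrightarrow> y \<in> N \<Longrightarrow> x \<ominus>\<^bsub>M\<^esub> y \<in> N"
    and "\<And>x. x \<in> N \<Longrightarrow> x \<in> carrier M"
proof -
  interpret N: submodule N R M by fact
  show sub: "N \<subseteq> carrier M" "\<zero>\<^bsub>M\<^esub> \<in> N"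
    and add: "\<And>x y. x \<in> N \<Longrightarrow> y \<in> N \<Longrightarrow> x \<oplus>\<^bsub>M\<^esub> y \<in> N"
    and smult: "\<And>a x. a \<in> carrier R \<Longrightarrow> x \<in> N \<Longrightarrow> a \<odot>\<^bsub>M\<^esub> x \<in> N"
    using N.subset N.one_closed N.m_closed by auto
  show neg: "\<And>x. x \<in> N \<Longrightarrow> \<ominus>\<^bsub>M\<^esub> x \<in> N"
    using smult[of "\<ominus> \<one>"] sub(1) by (simp add: neg_eq_smult subset_iff)
  show "\<And>x y. x \<in> N \<Longrightarrow> y \<in> N \<Longrightarrow> x \<ominus>\<^bsub>M\<^esub> y \<in> N"
    unfolding a_minus_def by (rule add[OF _ neg])
  show "\<And>x. x \<in> N \<Longrightarrow> x \<in> carrier M"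
    using sub by blast
qed

lemma submodule_carrier: "submodule (carrier M) R M"
  by (rule submodI) (auto simp: smult_closed)

lemma submodule_zero: "submodule {\<zero>\<^bsub>M\<^esub>} R M"
  by (rule submodI) auto

lemma submodule_Int:
  assumes "submodule N R M" "submodule U R M"
  shows "submodule (N \<inter> U) R M"
  using assms by (intro submodI) (auto dest: submodD)

text \<open>The factor \<open>carrier M\<close> admits the empty family; this covers the radical of
  a module that has no maximal submodule.\<close>

lemma submodule_Inter:
  assumes "\<And>N. N \<in> \<N> \<Longrightarrow> submodule N R M"
  shows "submodule (carrier M \<inter> \<Inter>\<N>) R M"
  using assms by (intro submodI) (auto dest: submodD intro: smult_closed)

lemma lspan_eq: "S \<subseteq> carrier M \<Longrightarrow> lspan R M S = carrier M \<inter> \<Inter>{N. submodule N R M \<and> S \<subseteq> N}"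
  unfolding lspan_def using submodule_carrier by blast

lemma lspan_submodule: "S \<subseteq> carrier M \<Longrightarrow> submodule (lspan R M S) R M"
  unfolding lspan_eq by (rule submodule_Inter) blast

lemma lspan_superset: "S \<subseteq> lspan R M S"
  unfolding lspan_def by blast

lemma lspan_least: "submodule N R M \<Longrightarrow> S \<subseteq> N \<Longrightarrow> lspan R M S \<subseteq> N"
  unfolding lspan_def by blast

text \<open>As \<open>lspan\<close> is an intersection of submodules, generation can be tested one
  submodule at a time. Images and preimages of submodules are submodules, so this form passes easily
  along homomorphisms.\<close>

lemma fin_gen_iff:
  "fin_gen R M \<longleftrightarrow> (\<exists>S. finite S \<and> S \<subseteq> carrier M \<and>
    (\<forall>U. submodule U R M \<and> S \<subseteq> U \<longrightarrow> carrier M \<subseteq> U))" (is "?L \<longleftrightarrow> ?R")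
proof
  assume ?L
  then show ?R
    unfolding fin_gen_def using lspan_least by metis
next
  assume ?R
  then obtain S where S: "finite S" "S \<subseteq> carrier M"
    "\<forall>U. submodule U R M \<and> S \<subseteq> U \<longrightarrow> carrier M \<subseteq> U" by auto
  have "carrier M \<subseteq> lspan R M S"
    using S(3) lspan_submodule[OF S(2)] lspan_superset[of S] by simp
  then have "lspan R M S = carrier M"
    using lspan_least[OF submodule_carrier S(2)] by simp
  with S show ?L
    unfolding fin_gen_def by metis
qed

end

text \<open>The premise \<open>zero_smult\<close> stands in for additive inverses: (-1)x + x = 0x =
  0.\<close>

lemma left_moduleI:
  fixes R (structure) and M (structure)
  assumes "ring R"
    and "\<And>x y. x \<in> carrier M \<Longrightarrow> y \<in> carrier M \<Longrightarrow> x \<oplus>\<^bsub>M\<^esub> y \<in> carrier M"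
    and "\<zero>\<^bsub>M\<^esub> \<in> carrier M"
    and "\<And>x y z. x \<in> carrier M \<Longrightarrow> y \<in> carrier M \<Longrightarrow> z \<in> carrier M \<Longrightarrow>
      (x \<oplus>\<^bsub>M\<^esub> y) \<oplus>\<^bsub>M\<^esub> z = x \<oplus>\<^bsub>M\<^esub> (y \<oplus>\<^bsub>M\<^esub> z)"
    and "\<And>x y. x \<in> carrier M \<Longrightarrow> y \<in> carrier M \<Longrightarrow> x \<oplus>\<^bsub>M\<^esub> y = y \<oplus>\<^bsub>M\<^esub> x"
    and zero: "\<And>x. x \<in> carrier M \<Longrightarrow> \<zero>\<^bsub>M\<^esub> \<oplus>\<^bsub>M\<^esub> x = x"
    and smult: "\<And>a x. a \<in> carrier R \<Longrightarrow> x \<in> carrier M \<Longrightarrow> a \<odot>\<^bsub>M\<^esub> x \<in> carrier M"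
    and smult_distr: "\<And>a b x. a \<in> carrier R \<Longrightarrow> b \<in> carrier R \<Longrightarrow> x \<in> carrier M \<Longrightarrow>
      (a \<oplus> b) \<odot>\<^bsub>M\<^esub> x = a \<odot>\<^bsub>M\<^esub> x \<oplus>\<^bsub>M\<^esub> b \<odot>\<^bsub>M\<^esub> x"
    and "\<And>a x y. a \<in> carrier R \<Longrightarrow> x \<in> carrier M \<Longrightarrow> y \<in> carrier M \<Longrightarrow>
      a \<odot>\<^bsub>M\<^esub> (x \<oplus>\<^bsub>M\<^esub> y) = a \<odot>\<^bsub>M\<^esub> x \<oplus>\<^bsub>M\<^esub> a \<odot>\<^bsub>M\<^esub> y"
    and "\<And>a b x. a \<in> carrier R \<Longrightarrow> b \<in> carrier R \<Longrightarrow> x \<in> carrier M \<Longrightarrow>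
      (a \<otimes> b) \<odot>\<^bsub>M\<^esub> x = a \<odot>\<^bsub>M\<^esub> (b \<odot>\<^bsub>M\<^esub> x)"
    and one: "\<And>x. x \<in> carrier M \<Longrightarrow> \<one> \<odot>\<^bsub>M\<^esub> x = x"
    and zero_smult: "\<And>x. x \<in> carrier M \<Longrightarrow> \<zero> \<odot>\<^bsub>M\<^esub> x = \<zero>\<^bsub>M\<^esub>"
  shows "left_module R M"
proof -
  interpret ring R by fact
  have "(\<ominus> \<one>) \<odot>\<^bsub>M\<^esub> x \<oplus>\<^bsub>M\<^esub> x = \<zero>\<^bsub>M\<^esub>" if "x \<in> carrier M" for x
    using that smult_distr[of "\<ominus> \<one>" \<one> x] one[of x] zero_smult[of x] by (simp add: l_neg)
  then have "\<exists>y\<in>carrier M. y \<oplus>\<^bsub>M\<^esub> x = \<zero>\<^bsub>M\<^esub>" if "x \<in> carrier M" for x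
    using that smult by blast
  then have "abelian_group M"
    using assms by (intro abelian_groupI) auto
  then show ?thesis
    using assms by (intro left_module.intro left_module_axioms.intro) auto
qed

lemma sub_mod_simps [simp]:
  "carrier (sub_mod M N) = N" "ring.add (sub_mod M N) = ring.add M" "ring.zero (sub_mod M N) = ring.zero M"
  "module.smult (sub_mod M N) = module.smult M" "sub_mod (sub_mod M N) U = sub_mod M U"
  "sub_mod M (carrier M) = M"
  by (simp_all add: sub_mod_def)

lemma sub_mod_left_module:
  assumes "left_module R M" "submodule N R M"
  shows "left_module R (sub_mod M N)"
proof -
  interpret left_module R M by fact
  note N = submodD[OF assms(2)]
  show ?thesis
    using N(1-4) by (intro left_moduleI)
      (auto simp: R.ring_axioms M.a_ac smult_l_distr smult_r_distr smult_assoc1 smult_one subsetD)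
qed

lemma sub_mod_submodule_iff:
  assumes "left_module R M" "submodule N R M"
  shows "submodule U R (sub_mod M N) \<longleftrightarrow> submodule U R M \<and> U \<subseteq> N"
proof -
  interpret left_module R M by fact
  interpret N: left_module R "sub_mod M N" using assms by (rule sub_mod_left_module)
  show ?thesis
    using submodD[OF assms(2)] N.submodD(1-4)[of U] submodD(1-4)[of U]
    by (auto intro!: N.submodI submodI)
qed

text \<open>The test submodules may range over all of M: intersecting one with N gives a submodule
  of N containing the same generators. In this form generation over two scalar rings is compared by
  comparing their submodules.\<close>

lemma fin_gen_sub_mod_iff:
  assumes "left_module R M" "submodule N R M"
  shows "fin_gen R (sub_mod M N) \<longleftrightarrow> (\<exists>S. finite S \<and> S \<subseteq> N \<and>
    (\<forall>U. submodule U R M \<and> S \<subseteq> U \<longrightarrow> N \<subseteq> U))" (is "_ \<longleftrightarrow> (\<exists>S. ?P S)")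
proof -
  interpret left_module R M by fact
  interpret N: left_module R "sub_mod M N" using assms by (rule sub_mod_left_module)
  have *: "(\<forall>U. submodule U R M \<and> U \<subseteq> N \<and> S \<subseteq> U \<longrightarrow> N \<subseteq> U) \<longleftrightarrow>
      (\<forall>U. submodule U R M \<and> S \<subseteq> U \<longrightarrow> N \<subseteq> U)" if "S \<subseteq> N" for S
    using that submodule_Int[OF assms(2)] by (metis Int_lower1 le_inf_iff)
  show ?thesis
    unfolding N.fin_gen_iff sub_mod_submodule_iff[OF assms] sub_mod_simps
    using * by (metis (no_types, lifting))
qed

lemma regular_simps [simp]:
  "carrier (regular R) = carrier R" "ring.add (regular R) = ring.add R" "ring.zero (regular R) = ring.zero R"
  "module.smult (regular R) = monoid.mult R"
  by (simp_all add: regular_def)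

lemma regular_left_module: "ring R \<Longrightarrow> left_module R (regular R)"
proof -
  assume "ring R"
  then interpret ring R .
  show ?thesis
    by (intro left_moduleI) (auto simp: ring_axioms a_ac l_distr r_distr m_assoc)
qed

subsection \<open>Homomorphisms\<close>

lemma lhomI:
  assumes "\<And>x. x \<in> carrier M \<Longrightarrow> f x \<in> carrier N"
    and "\<And>x y. x \<in> carrier M \<Longrightarrow> y \<in> carrier M \<Longrightarrow> f (x \<oplus>\<^bsub>M\<^esub> y) = f x \<oplus>\<^bsub>N\<^esub> f y"
    and "\<And>a x. a \<in> carrier R \<Longrightarrow> x \<in> carrier M \<Longrightarrow> f (a \<odot>\<^bsub>M\<^esub> x) = a \<odot>\<^bsub>N\<^esub> f x"
  shows "f \<in> lhom R M N"
  using assms unfolding lhom_def by auto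

lemma lhomD:
  assumes "f \<in> lhom R M N"
  shows "\<And>x. x \<in> carrier M \<Longrightarrow> f x \<in> carrier N"
    and "\<And>x y. x \<in> carrier M \<Longrightarrow> y \<in> carrier M \<Longrightarrow> f (x \<oplus>\<^bsub>M\<^esub> y) = f x \<oplus>\<^bsub>N\<^esub> f y"
    and "\<And>a x. a \<in> carrier R \<Longrightarrow> x \<in> carrier M \<Longrightarrow> f (a \<odot>\<^bsub>M\<^esub> x) = a \<odot>\<^bsub>N\<^esub> f x"
  using assms unfolding lhom_def by auto

lemma lhom_zero:
  assumes "left_module R M" "left_module R N" "f \<in> lhom R M N"
  shows "f \<zero>\<^bsub>M\<^esub> = \<zero>\<^bsub>N\<^esub>"
proof -
  interpret M: left_module R M by fact
  interpret N: left_module R N by fact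
  show ?thesis
    using lhomD(3)[OF assms(3), of "\<zero>\<^bsub>R\<^esub>" "\<zero>\<^bsub>M\<^esub>"] lhomD(1)[OF assms(3), of "\<zero>\<^bsub>M\<^esub>"] by simp
qed

lemma lhom_minus:
  assumes "left_module R M" "left_module R N" "f \<in> lhom R M N" "x \<in> carrier M" "y \<in> carrier M"
  shows "f (x \<ominus>\<^bsub>M\<^esub> y) = f x \<ominus>\<^bsub>N\<^esub> f y"
proof -
  interpret M: left_module R M by fact
  interpret N: left_module R N by fact
  show ?thesis
    using assms(4,5) lhomD[OF assms(3)]
    by (simp add: a_minus_def M.neg_eq_smult N.neg_eq_smult M.smult_closed)
qed

lemma lhom_comp:
  assumes "f \<in> lhom R M N" "g \<in> lhom R N K"
  shows "(\<lambda>x. g (f x)) \<in> lhom R M K"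
  using lhomD[OF assms(1)] lhomD[OF assms(2)] by (intro lhomI) auto

lemma lhom_ident: "(\<lambda>x. x) \<in> lhom R M M"
  by (intro lhomI) auto

lemma lhom_incl:
  assumes "N \<subseteq> carrier M" shows "(\<lambda>x. x) \<in> lhom R (sub_mod M N) M"
  using assms by (intro lhomI) auto

lemma lhom_restrict:
  assumes "f \<in> lhom R M K" "N \<subseteq> carrier M" shows "f \<in> lhom R (sub_mod M N) K"
  using assms(2) lhomD[OF assms(1)] by (intro lhomI) (auto simp: subset_iff)

lemma lhom_corestrict:
  assumes "f \<in> lhom R M K" "\<And>x. x \<in> carrier M \<Longrightarrow> f x \<in> U" shows "f \<in> lhom R M (sub_mod K U)"
  using assms lhomD[OF assms(1)] by (intro lhomI) auto

lemma lhom_sub_modD: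
  assumes "f \<in> lhom R M (sub_mod K U)" "U \<subseteq> carrier K" shows "f \<in> lhom R M K"
  using assms lhomD[OF assms(1)] by (intro lhomI) auto

lemma lhom_cong:
  assumes "left_module R M" "f \<in> lhom R M N" "\<And>x. x \<in> carrier M \<Longrightarrow> f x = g x"
  shows "g \<in> lhom R M N"
proof -
  interpret left_module R M by fact
  show ?thesis
    using lhomD[OF assms(2)] by (intro lhomI) (auto simp flip: assms(3) simp: smult_closed)
qed

lemma lhom_add:
  assumes "left_module R N" "f \<in> lhom R M N" "g \<in> lhom R M N"
  shows "(\<lambda>x. f x \<oplus>\<^bsub>N\<^esub> g x) \<in> lhom R M N"
proof -
  interpret N: left_module R N by fact
  show ?thesis
    using lhomD[OF assms(2)] lhomD[OF assms(3)]
    by (intro lhomI) (auto simp: N.smult_r_distr N.M.a_ac)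
qed

lemma lhom_diff:
  assumes "left_module R M" "left_module R N" "f \<in> lhom R M N" "g \<in> lhom R M N"
  shows "(\<lambda>x. f x \<ominus>\<^bsub>N\<^esub> g x) \<in> lhom R M N"
proof -
  interpret M: left_module R M by fact
  interpret N: left_module R N by fact
  \<comment> \<open>The map -g is g precomposed with scaling by -1, which is linear even over a
    noncommutative ring because -1 is central.\<close>
  have "(\<lambda>x. g ((\<ominus>\<^bsub>R\<^esub> \<one>\<^bsub>R\<^esub>) \<odot>\<^bsub>M\<^esub> x)) \<in> lhom R M N"
  proof (rule lhom_comp[OF _ assms(4)], rule lhomI)
    fix a x assume "a \<in> carrier R" "x \<in> carrier M"
    then show "\<ominus>\<^bsub>R\<^esub> \<one>\<^bsub>R\<^esub> \<odot>\<^bsub>M\<^esub> (a \<odot>\<^bsub>M\<^esub> x) = a \<odot>\<^bsub>M\<^esub> (\<ominus>\<^bsub>R\<^esub> \<one>\<^bsub>R\<^esub> \<odot>\<^bsub>M\<^esub> x)"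
      by (simp flip: M.smult_assoc1 add: M.R.l_minus M.R.r_minus)
  qed (auto simp: M.smult_closed M.smult_r_distr)
  from lhom_add[OF assms(2,3) this] show ?thesis
    by (rule lhom_cong[OF assms(1)])
      (simp add: a_minus_def N.neg_eq_smult lhomD[OF assms(4)])
qed

lemma lhom_image_submodule:
  assumes "left_module R M" "left_module R K" "f \<in> lhom R M K" "submodule N R M"
  shows "submodule (f ` N) R K"
proof -
  interpret M: left_module R M by fact
  interpret K: left_module R K by fact
  note N = M.submodD[OF assms(4)] and f = lhomD[OF assms(3)]
  show ?thesis
  proof (rule K.submodI)
    show "\<zero>\<^bsub>K\<^esub> \<in> f ` N"
      using N(2) lhom_zero[OF assms(1-3)] by (metis imageI)
    show "x \<oplus>\<^bsub>K\<^esub> y \<in> f ` N" if "x \<in> f ` N" "y \<in> f ` N" for x y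
      using that N(3,7) f(2) by (auto simp flip: f(2))
    show "a \<odot>\<^bsub>K\<^esub> x \<in> f ` N" if "a \<in> carrier R" "x \<in> f ` N" for a x
      using that N(4,7) by (auto simp flip: f(3))
  qed (use N f in auto)
qed

lemma lhom_vimage_submodule:
  assumes "left_module R M" "left_module R K" "f \<in> lhom R M K" "submodule U R K"
  shows "submodule {x \<in> carrier M. f x \<in> U} R M"
proof -
  interpret M: left_module R M by fact
  interpret K: left_module R K by fact
  show ?thesis
    using K.submodD[OF assms(4)] lhomD[OF assms(3)] lhom_zero[OF assms(1-3)]
    by (intro M.submodI) (auto simp: M.smult_closed)
qed

lemma a_kernel_submodule:
  assumes "left_module R M" "left_module R K" "f \<in> lhom R M K"
  shows "submodule (a_kernel M K f) R M"
  using lhom_vimage_submodule[OF assms left_module.submodule_zero[OF assms(2)]]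
  by (simp add: a_kernel_def')

lemma ker_mod_simps [simp]:
  "carrier (ker_mod M K f) = a_kernel M K f" "ring.add (ker_mod M K f) = ring.add M"
  "ring.zero (ker_mod M K f) = ring.zero M" "module.smult (ker_mod M K f) = module.smult M"
  by (simp_all add: ker_mod_def)

lemma ker_mod_left_module:
  assumes "left_module R M" "left_module R K" "f \<in> lhom R M K"
  shows "left_module R (ker_mod M K f)"
  unfolding ker_mod_def using assms by (intro sub_mod_left_module a_kernel_submodule)


subsection \<open>Finitely generated and Noetherian modules\<close>

lemma fin_gen_image:
  assumes "left_module R M" "left_module R K" "f \<in> lhom R M K" "f ` carrier M = carrier K"
    and "fin_gen R M"
  shows "fin_gen R K"
proof -
  interpret M: left_module R M by fact
  interpret K: left_module R K by fact
  obtain S where S: "finite S" "S \<subseteq> carrier M"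
    "\<And>U. submodule U R M \<Longrightarrow> S \<subseteq> U \<Longrightarrow> carrier M \<subseteq> U"
    using assms(5) unfolding M.fin_gen_iff by auto
  have "carrier K \<subseteq> U" if U: "submodule U R K" "f ` S \<subseteq> U" for U
  proof -
    have "carrier M \<subseteq> {x \<in> carrier M. f x \<in> U}"
      using S(2) U(2) by (intro S(3) lhom_vimage_submodule[OF assms(1-3) U(1)]) auto
    then show ?thesis
      unfolding assms(4)[symmetric] by auto
  qed
  with S(1,2) assms(4) show ?thesis
    unfolding K.fin_gen_iff by (intro exI[of _ "f ` S"]) auto
qed

text \<open>Lifts of generators of K together with generators of the kernel suffice: a submodule
  containing the lifts has, for each x, an element y with the same image, and x - y lies in the
  kernel.\<close>

lemma fin_gen_extension:
  assumes M: "left_module R M" and K: "left_module R K"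
    and f: "f \<in> lhom R M K" "f ` carrier M = carrier K"
    and "fin_gen R K" and "fin_gen R (ker_mod M K f)"
  shows "fin_gen R M"
proof -
  interpret M: left_module R M by fact
  interpret K: left_module R K by fact
  note ker = a_kernel_submodule[OF M K f(1)]
  obtain T where T: "finite T" "T \<subseteq> carrier K"
    "\<And>U. submodule U R K \<Longrightarrow> T \<subseteq> U \<Longrightarrow> carrier K \<subseteq> U"
    using assms(5) unfolding K.fin_gen_iff by auto
  obtain T' where T': "finite T'" "T' \<subseteq> carrier M" "T = f ` T'"
    using T(1,2) finite_subset_image[of T f "carrier M"] f(2) by auto
  obtain S where S: "finite S" "S \<subseteq> a_kernel M K f"
    "\<And>U. submodule U R M \<Longrightarrow> S \<subseteq> U \<Longrightarrow> a_kernel M K f \<subseteq> U"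
    using assms(6) unfolding ker_mod_def fin_gen_sub_mod_iff[OF M ker] by auto
  have "carrier M \<subseteq> U" if U: "submodule U R M" "T' \<union> S \<subseteq> U" for U
  proof
    fix x assume x: "x \<in> carrier M"
    note ker_U = S(3)[OF U(1)]
    have "carrier K \<subseteq> f ` U"
      using U(2) T'(3) by (intro T(3) lhom_image_submodule[OF M K f(1) U(1)]) auto
    then obtain y where y: "y \<in> U" "f x = f y"
      using lhomD(1)[OF f(1) x] by auto
    have yM: "y \<in> carrier M"
      using M.submodD(7)[OF U(1) y(1)] .
    have "x \<ominus>\<^bsub>M\<^esub> y \<in> a_kernel M K f"
      using x yM lhom_minus[OF M K f(1) x yM] lhomD(1)[OF f(1)] y(2)
      by (simp add: a_kernel_def' K.minus_self)
    then have "y \<oplus>\<^bsub>M\<^esub> (x \<ominus>\<^bsub>M\<^esub> y) \<in> U"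
      using ker_U U(2) y(1) M.submodD(3)[OF U(1)] by auto
    then show "x \<in> U"
      by (simp add: M.add_minus_cancel x yM)
  qed
  moreover have "S \<subseteq> carrier M"
    using S(2) M.submodD(1)[OF ker] by auto
  ultimately show ?thesis
    unfolding M.fin_gen_iff using S(1) T'(1,2) by (intro exI[of _ "T' \<union> S"]) auto
qed

text \<open>Finite generation of submodules is taken instead of the ascending chain condition: it is
  what the syzygies require, and it passes through extensions by
  \<open>fin_gen_extension\<close>.\<close>

definition noetherian_module :: "('a, 'r) ring_scheme \<Rightarrow> ('a, 'm) module \<Rightarrow> bool"
  where "noetherian_module R M \<longleftrightarrow> (\<forall>N. submodule N R M \<longrightarrow> fin_gen R (sub_mod M N))"

text \<open>Each submodule of K is the image of its preimage in M.\<close>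

lemma noetherian_image:
  assumes M: "left_module R M" and K: "left_module R K"
    and f: "f \<in> lhom R M K" "f ` carrier M = carrier K"
    and "noetherian_module R M"
  shows "noetherian_module R K"
  unfolding noetherian_module_def
proof (intro allI impI)
  fix N assume N: "submodule N R K"
  let ?N = "{x \<in> carrier M. f x \<in> N}"
  note V = lhom_vimage_submodule[OF M K f(1) N]
  have "f ` ?N = N"
    using f(2) left_module.submodD(1)[OF K N] by (auto simp: subset_iff image_iff)
  moreover have "f \<in> lhom R (sub_mod M ?N) (sub_mod K N)"
    by (intro lhom_corestrict lhom_restrict f) auto
  moreover have "fin_gen R (sub_mod M ?N)"
    using assms(5) V unfolding noetherian_module_def by blast
  ultimately show "fin_gen R (sub_mod K N)"
    by (intro fin_gen_image[of R "sub_mod M ?N" "sub_mod K N" f] sub_mod_left_module M K V N) auto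
qed

text \<open>A submodule N is an extension of its image by its intersection with the kernel, and both
  are finitely generated. Only the restriction of f to N, corestricted to the image of N, has to be
  onto.\<close>

lemma noetherian_extension:
  assumes M: "left_module R M" and K: "left_module R K" and f: "f \<in> lhom R M K"
    and "noetherian_module R K" and "noetherian_module R (ker_mod M K f)"
  shows "noetherian_module R M"
  unfolding noetherian_module_def
proof (intro allI impI)
  fix N assume N: "submodule N R M"
  interpret M: left_module R M by fact
  note N' = M.submodD(1)[OF N]
  note ker = a_kernel_submodule[OF M K f]
  note im = lhom_image_submodule[OF M K f N]
  have eq: "ker_mod (sub_mod M N) (sub_mod K (f ` N)) f = sub_mod (ker_mod M K f) (N \<inter> a_kernel M K f)"
    using N' by (auto simp: ker_mod_def a_kernel_def' intro!: arg_cong[of _ _ "sub_mod M"])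
  have "submodule (N \<inter> a_kernel M K f) R (ker_mod M K f)"
    unfolding ker_mod_def sub_mod_submodule_iff[OF M ker]
    using M.submodule_Int[OF N ker] by simp
  then have "fin_gen R (ker_mod (sub_mod M N) (sub_mod K (f ` N)) f)"
    unfolding eq using assms(5) unfolding noetherian_module_def by blast
  moreover have "fin_gen R (sub_mod K (f ` N))"
    using assms(4) im unfolding noetherian_module_def by blast
  moreover have "f \<in> lhom R (sub_mod M N) (sub_mod K (f ` N))"
    by (intro lhom_corestrict lhom_restrict f N') auto
  ultimately show "fin_gen R (sub_mod M N)"
    by (intro fin_gen_extension[of R "sub_mod M N" "sub_mod K (f ` N)" f] sub_mod_left_module
        M K N im) auto
qed

subsection \<open>Free modules of finite rank\<close>

text \<open>With the value zero off I, R^I is literally the kernel of the i-th coordinate on R^(I +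
  i), which drives the induction on the rank. For I a set of elements of P the type is the one on
  which \<open>projective_module\<close> tests its epimorphisms.\<close>

definition free_module :: "('a, 'r) ring_scheme \<Rightarrow> 'i set \<Rightarrow> ('a, 'i \<Rightarrow> 'a) module"
  where "free_module R I = \<lparr>carrier = {c. (\<forall>i\<in>I. c i \<in> carrier R) \<and> (\<forall>i. i \<notin> I \<longrightarrow> c i = \<zero>\<^bsub>R\<^esub>)},
    monoid.mult = undefined, monoid.one = undefined, ring.zero = (\<lambda>i. \<zero>\<^bsub>R\<^esub>),
    ring.add = (\<lambda>c d i. c i \<oplus>\<^bsub>R\<^esub> d i), module.smult = (\<lambda>a c i. a \<otimes>\<^bsub>R\<^esub> c i)\<rparr>"

lemma free_module_simps:
  "carrier (free_module R I) = {c. (\<forall>i\<in>I. c i \<in> carrier R) \<and> (\<forall>i. i \<notin> I \<longrightarrow> c i = \<zero>\<^bsub>R\<^esub>)}"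
  "ring.zero (free_module R I) = (\<lambda>i. \<zero>\<^bsub>R\<^esub>)"
  "ring.add (free_module R I) = (\<lambda>c d i. c i \<oplus>\<^bsub>R\<^esub> d i)"
  "module.smult (free_module R I) = (\<lambda>a c i. a \<otimes>\<^bsub>R\<^esub> c i)"
  by (simp_all add: free_module_def)

lemma free_module_closed:
  "ring R \<Longrightarrow> c \<in> carrier (free_module R I) \<Longrightarrow> c i \<in> carrier R"
  by (cases "i \<in> I") (auto simp: free_module_simps intro: ring.ring_simprules)

lemma free_module_left_module:
  fixes R (structure)
  assumes "ring R" shows "left_module R (free_module R I)"
proof -
  interpret ring R by fact
  note closed = free_module_closed[OF assms, where I = I]
  show ?thesis
  proof (rule left_moduleI)
    fix x y z assume "x \<in> carrier (free_module R I)" "y \<in> carrier (free_module R I)"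
      "z \<in> carrier (free_module R I)"
    then show "x \<oplus>\<^bsub>free_module R I\<^esub> y \<oplus>\<^bsub>free_module R I\<^esub> z =
        x \<oplus>\<^bsub>free_module R I\<^esub> (y \<oplus>\<^bsub>free_module R I\<^esub> z)"
      by (simp add: closed free_module_simps(2-4) a_assoc)
  next
    fix a b x assume "a \<in> carrier R" "b \<in> carrier R" "x \<in> carrier (free_module R I)"
    then show "(a \<oplus> b) \<odot>\<^bsub>free_module R I\<^esub> x =
        a \<odot>\<^bsub>free_module R I\<^esub> x \<oplus>\<^bsub>free_module R I\<^esub> b \<odot>\<^bsub>free_module R I\<^esub> x"
      and "a \<otimes> b \<odot>\<^bsub>free_module R I\<^esub> x = a \<odot>\<^bsub>free_module R I\<^esub> (b \<odot>\<^bsub>free_module R I\<^esub> x)"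
      by (simp_all add: closed free_module_simps(2-4) l_distr m_assoc)
  next
    fix x y assume "x \<in> carrier (free_module R I)" "y \<in> carrier (free_module R I)"
    then show "x \<oplus>\<^bsub>free_module R I\<^esub> y = y \<oplus>\<^bsub>free_module R I\<^esub> x"
      by (auto simp: closed free_module_simps(2-4) a_comm)
  next
    fix a x y assume "a \<in> carrier R" "x \<in> carrier (free_module R I)" "y \<in> carrier (free_module R I)"
    then show "a \<odot>\<^bsub>free_module R I\<^esub> (x \<oplus>\<^bsub>free_module R I\<^esub> y) =
        a \<odot>\<^bsub>free_module R I\<^esub> x \<oplus>\<^bsub>free_module R I\<^esub> a \<odot>\<^bsub>free_module R I\<^esub> y"
      by (simp add: closed free_module_simps(2-4) r_distr)
  next
    fix x assume "x \<in> carrier (free_module R I)"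
    then show "\<zero>\<^bsub>free_module R I\<^esub> \<oplus>\<^bsub>free_module R I\<^esub> x = x"
      and "\<one> \<odot>\<^bsub>free_module R I\<^esub> x = x"
      and "\<zero> \<odot>\<^bsub>free_module R I\<^esub> x = \<zero>\<^bsub>free_module R I\<^esub>"
      by (simp_all add: closed free_module_simps(2-4))
  qed (simp_all add: free_module_simps ring_axioms)
qed

lemma free_module_coordinate:
  assumes "ring R" shows "(\<lambda>c. c i) \<in> lhom R (free_module R I) (regular R)"
  using free_module_closed[OF assms] by (intro lhomI) (auto simp: free_module_simps(2-4))

text \<open>Induction on I: the coordinate at the new index has values in the Noetherian module R
  and kernel R^I.\<close>

lemma noetherian_free_module:
  assumes "ring R" "noetherian_module R (regular R)" "finite I"
  shows "noetherian_module R (free_module R I)"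
  using assms(3)
proof induction
  case empty
  interpret left_module R "free_module R ({} :: 'c set)"
    using assms(1) by (rule free_module_left_module)
  have carrier: "carrier (free_module R ({} :: 'c set)) = {\<zero>\<^bsub>free_module R {}\<^esub>}"
    by (auto simp: free_module_simps)
  show ?case
    unfolding noetherian_module_def
  proof (intro allI impI)
    fix N :: "('c \<Rightarrow> 'a) set" assume N: "submodule N R (free_module R {})"
    show "fin_gen R (sub_mod (free_module R {}) N)"
      unfolding fin_gen_sub_mod_iff[OF left_module_axioms N]
      using submodD(1)[OF N] submodD(2) unfolding carrier by (intro exI[of _ "{}"]) blast
  qed
next
  case (insert i I)
  have "ker_mod (free_module R (insert i I)) (regular R) (\<lambda>c. c i) = free_module R I"
    using insert(2) ring.ring_simprules(2)[OF assms(1)]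
    by (auto simp: ker_mod_def sub_mod_def a_kernel_def' free_module_def)
  then show ?case
    using insert(3) assms
    by (intro noetherian_extension[OF free_module_left_module regular_left_module
          free_module_coordinate[of R i]]) auto
qed

section \<open>Linear combinations as maps out of a free module\<close>

definition lin_comb :: "('a, 'm) module \<Rightarrow> 'i set \<Rightarrow> ('i \<Rightarrow> 'm) \<Rightarrow> ('i \<Rightarrow> 'a) \<Rightarrow> 'm"
  where "lin_comb M I b c = (\<Oplus>\<^bsub>M\<^esub>i\<in>I. c i \<odot>\<^bsub>M\<^esub> b i)"

lemma lin_comb_lhom:
  assumes "left_module R M" "finite I" "b \<in> I \<rightarrow> carrier M"
  shows "lin_comb M I b \<in> lhom R (free_module R I) M"
proof -
  interpret left_module R M by fact
  have smult_finsum: "a \<odot>\<^bsub>M\<^esub> (\<Oplus>\<^bsub>M\<^esub>i\<in>I. f i) = (\<Oplus>\<^bsub>M\<^esub>i\<in>I. a \<odot>\<^bsub>M\<^esub> f i)"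
    if "a \<in> carrier R" "f \<in> I \<rightarrow> carrier M" for a f
    using assms(2) that(2)
    by induction (simp_all add: that(1) Pi_def smult_r_distr smult_closed M.finsum_closed)
  show ?thesis
    unfolding lin_comb_def
  proof (rule lhomI)
    fix c assume c: "c \<in> carrier (free_module R I)"
    note c' = free_module_closed[OF R.ring_axioms c]
    show "(\<Oplus>\<^bsub>M\<^esub>i\<in>I. c i \<odot>\<^bsub>M\<^esub> b i) \<in> carrier M"
      using c' assms(3) by (intro M.finsum_closed) (auto intro: smult_closed)
    show "(\<Oplus>\<^bsub>M\<^esub>i\<in>I. (c \<oplus>\<^bsub>free_module R I\<^esub> d) i \<odot>\<^bsub>M\<^esub> b i) =
        (\<Oplus>\<^bsub>M\<^esub>i\<in>I. c i \<odot>\<^bsub>M\<^esub> b i) \<oplus>\<^bsub>M\<^esub> (\<Oplus>\<^bsub>M\<^esub>i\<in>I. d i \<odot>\<^bsub>M\<^esub> b i)"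
      if d: "d \<in> carrier (free_module R I)" for d
    proof -
      note d' = free_module_closed[OF R.ring_axioms d]
      have "(\<Oplus>\<^bsub>M\<^esub>i\<in>I. (c \<oplus>\<^bsub>free_module R I\<^esub> d) i \<odot>\<^bsub>M\<^esub> b i) =
          (\<Oplus>\<^bsub>M\<^esub>i\<in>I. c i \<odot>\<^bsub>M\<^esub> b i \<oplus>\<^bsub>M\<^esub> d i \<odot>\<^bsub>M\<^esub> b i)"
        using c' d' assms(3)
        by (intro M.finsum_cong') (auto simp: free_module_simps(2-4) smult_l_distr smult_closed Pi_def)
      then show ?thesis
        using c' d' assms(3) by (subst (asm) M.finsum_addf) (auto simp: smult_closed Pi_def)
    qed
    show "(\<Oplus>\<^bsub>M\<^esub>i\<in>I. (a \<odot>\<^bsub>free_module R I\<^esub> c) i \<odot>\<^bsub>M\<^esub> b i) = a \<odot>\<^bsub>M\<^esub> (\<Oplus>\<^bsub>M\<^esub>i\<in>I. c i \<odot>\<^bsub>M\<^esub> b i)"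
      if a: "a \<in> carrier R" for a
      using c' a assms(3)
      by (subst smult_finsum)
        (auto simp: free_module_simps(2-4) smult_assoc1 Pi_def smult_closed intro!: M.finsum_cong')
  qed
qed

lemma lin_comb_image:
  assumes "left_module R M" "left_module R K" "f \<in> lhom R M K" "finite I" "b \<in> I \<rightarrow> carrier M"
    and "c \<in> carrier (free_module R I)"
  shows "f (lin_comb M I b c) = lin_comb K I (\<lambda>i. f (b i)) c"
proof -
  interpret M: left_module R M by fact
  interpret K: left_module R K by fact
  note f = lhomD[OF assms(3)]
  note c = free_module_closed[OF M.R.ring_axioms assms(6)]
  show ?thesis
    unfolding lin_comb_def using assms(4,5)
    by induction (simp_all add: lhom_zero[OF assms(1-3)] f c Pi_def M.smult_closed K.smult_closed
        M.M.finsum_closed)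
qed

lemma lin_comb_unit:
  assumes "left_module R M" "finite I" "b \<in> I \<rightarrow> carrier M" "i \<in> I"
  shows "\<exists>c\<in>carrier (free_module R I). lin_comb M I b c = b i"
proof
  interpret left_module R M by fact
  let ?c = "\<lambda>j. if j = i then \<one>\<^bsub>R\<^esub> else \<zero>\<^bsub>R\<^esub>"
  show "?c \<in> carrier (free_module R I)"
    using assms(4) by (auto simp: free_module_simps)
  have "(\<Oplus>\<^bsub>M\<^esub>j\<in>I. ?c j \<odot>\<^bsub>M\<^esub> b j) = (\<Oplus>\<^bsub>M\<^esub>j\<in>I. if i = j then b j else \<zero>\<^bsub>M\<^esub>)"
    using assms(3) by (intro M.finsum_cong') (auto simp: smult_one Pi_iff)
  also have "\<dots> = b i"
    using M.add.finprod_singleton[OF assms(4,2), of b] assms(3) by simp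
  finally show "lin_comb M I b ?c = b i"
    by (simp add: lin_comb_def)
qed

text \<open>The image is a submodule, and the unit vectors show that it contains every
  generator.\<close>

lemma lin_comb_surj:
  assumes "left_module R M" "finite I" "b \<in> I \<rightarrow> carrier M" "lspan R M (b ` I) = carrier M"
  shows "lin_comb M I b ` carrier (free_module R I) = carrier M"
proof
  interpret left_module R M by fact
  note hom = lin_comb_lhom[OF assms(1-3)]
  note F = free_module_left_module[OF R.ring_axioms, of I]
  show "lin_comb M I b ` carrier (free_module R I) \<subseteq> carrier M"
    using lhomD(1)[OF hom] by auto
  have "b ` I \<subseteq> lin_comb M I b ` carrier (free_module R I)"
    using lin_comb_unit[OF assms(1-3)] by (auto simp: image_iff) metis
  then show "carrier M \<subseteq> lin_comb M I b ` carrier (free_module R I)"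
    using lhom_image_submodule[OF F assms(1) hom left_module.submodule_carrier[OF F]]
    unfolding assms(4)[symmetric] by (intro lspan_least) auto
qed

text \<open>Indexing generators by an initial segment of the naturals puts the free module on the
  type \<open>nat \<Rightarrow> 'a\<close>, whatever the type of M. This is the origin of the type
  of Q in the theorem.\<close>

lemma free_module_cover:
  fixes M :: "('a, 'm) module"
  assumes "left_module R M" "fin_gen R M"
  obtains n b where "b \<in> {..<n::nat} \<rightarrow> carrier M"
    and "lin_comb M {..<n} b ` carrier (free_module R {..<n}) = carrier M"
proof -
  obtain S where S: "finite S" "S \<subseteq> carrier M" "lspan R M S = carrier M"
    using assms(2) unfolding fin_gen_def by blast
  obtain b :: "nat \<Rightarrow> 'm" and n where b: "S = b ` {i. i < n}"
    using finite_imp_nat_seg_image_inj_on[OF S(1)] by blast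
  have S_eq: "S = b ` {..<n}"
    unfolding b by auto
  have mem: "b \<in> {..<n} \<rightarrow> carrier M"
    using S(2) unfolding S_eq by auto
  show ?thesis
    using S(3) by (intro that[of b n] mem lin_comb_surj[OF assms(1) _ mem]) (auto simp: S_eq)
qed

text \<open>M is a quotient of some R^n.\<close>

lemma fin_gen_imp_noetherian:
  assumes "left_module R M" "fin_gen R M" "noetherian_module R (regular R)"
  shows "noetherian_module R M"
proof -
  interpret left_module R M by fact
  obtain n b where "b \<in> {..<n::nat} \<rightarrow> carrier M"
    "lin_comb M {..<n} b ` carrier (free_module R {..<n}) = carrier M"
    using free_module_cover[OF assms(1,2)] .
  then show ?thesis
    by (intro noetherian_image[OF free_module_left_module[OF R.ring_axioms] assms(1) lin_comb_lhom]
        noetherian_free_module assms R.ring_axioms) auto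
qed

subsection \<open>Artinian commutative rings and Artin algebras\<close>

text \<open>Strict inclusion within the family is well-founded: an infinite strictly descending
  sequence would contradict the stabilization demanded by \<open>artinian_ring\<close>.\<close>

lemma artinian_minimal_ideal:
  assumes "artinian_ring R" "I0 \<in> \<I>" and ideals: "\<And>I. I \<in> \<I> \<Longrightarrow> submodule I R (regular R)"
  obtains I where "I \<in> \<I>" "\<And>J. J \<in> \<I> \<Longrightarrow> J \<subseteq> I \<Longrightarrow> J = I"
proof -
  have "wf {(J, I). J \<in> \<I> \<and> I \<in> \<I> \<and> J \<subset> I}" (is "wf ?r")
    unfolding wf_iff_no_infinite_down_chain
  proof
    assume "\<exists>f. \<forall>i. (f (Suc i), f i) \<in> ?r"
    then obtain f where f: "\<And>i. (f (Suc i), f i) \<in> ?r" by auto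
    then have "\<forall>n. submodule (f n) R (regular R) \<and> f (Suc n) \<subseteq> f n"
      using ideals by simp (metis psubset_imp_subset)
    then obtain m where "\<forall>n\<ge>m. f n = f m"
      using assms(1)[unfolded artinian_ring_def, THEN conjunct2, THEN spec[of _ f]] by blast
    then have "f (Suc m) = f m" using le_SucI[OF order_refl] by blast
    then show False using f[of m] by auto
  qed
  then have "\<exists>I\<in>\<I>. \<forall>J. (J, I) \<in> ?r \<longrightarrow> J \<notin> \<I>"
    using assms(2) by (rule wf_eq_minimal[THEN iffD1, rule_format])
  then obtain I where I: "I \<in> \<I>" "\<forall>J. (J, I) \<in> ?r \<longrightarrow> J \<notin> \<I>" ..
  show ?thesis
    using that[of I] I by blast
qed

text \<open>Commutativity makes scaling linear. The domain is an ideal because the kernel and the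
  image of the action of r on an ideal are what the next argument compares.\<close>

lemma (in cring) smult_lhom:
  assumes "r \<in> carrier R" "submodule I R (regular R)"
  shows "(\<lambda>x. r \<otimes> x) \<in> lhom R (sub_mod (regular R) I) (regular R)"
  using assms left_module.submodD(7)[OF regular_left_module[OF ring_axioms] assms(2)]
  by (intro lhomI) (auto simp: r_distr m_lcomm)

text \<open>
  A minimal non-finitely-generated ideal \<open>I\<close> is killed or mapped onto itself by every scalar, and
  in the latter case the scalar acts invertibly: \<open>I\<close> is a vector space over \<open>R / Ann(I)\<close>. A
  submodule of \<open>I\<close> maximal among those avoiding a nonzero \<open>x\<close> is then a finitely generated
  complement of the line through \<open>x\<close>.
\<close>

lemma artinian_imp_noetherian:
  fixes R (structure)
  assumes "cring R" "artinian_ring R"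
  shows "noetherian_module R (regular R)"
proof (rule ccontr)
  interpret cring R by fact
  let ?M = "regular R"
  have M: "left_module R ?M"
    by (rule regular_left_module[OF ring_axioms])
  interpret M: left_module R ?M by (fact M)
  let ?fg = "\<lambda>I. fin_gen R (sub_mod ?M I)"
  assume "\<not> noetherian_module R ?M"
  then obtain I0 where I0: "I0 \<in> {I. submodule I R ?M \<and> \<not> ?fg I}"
    unfolding noetherian_module_def by auto
  obtain I where I': "I \<in> {I. submodule I R ?M \<and> \<not> ?fg I}"
    "\<And>J. J \<in> {I. submodule I R ?M \<and> \<not> ?fg I} \<Longrightarrow> J \<subseteq> I \<Longrightarrow> J = I"
    using artinian_minimal_ideal[OF assms(2) I0] by (metis (no_types, lifting) mem_Collect_eq)
  then have I: "submodule I R ?M" and not_fg: "\<not> ?fg I"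
    and min: "\<And>J. submodule J R ?M \<Longrightarrow> J \<subseteq> I \<Longrightarrow> J \<noteq> I \<Longrightarrow> ?fg J"
    by auto
  note ID = M.submodD[OF I, simplified]
  \<comment> \<open>If neither holds, then rI and the kernel of r on I are both proper in I, hence
    finitely generated by minimality, and I is an extension of one by the other.\<close>
  have dich: "(\<lambda>x. r \<otimes> x) ` I = I \<or> (\<forall>x\<in>I. r \<otimes> x = \<zero>)" if r: "r \<in> carrier R" for r
  proof (rule ccontr)
    assume neg: "\<not> ?thesis"
    let ?f = "\<lambda>x. r \<otimes> x"
    note subI = sub_mod_left_module[OF M I]
    note f = smult_lhom[OF r I]
    have im: "submodule (?f ` I) R ?M"
      using lhom_image_submodule[OF subI M f left_module.submodule_carrier[OF subI]] by simp
    have "?fg (?f ` I)"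
      using neg r ID(4) by (intro min[OF im]) auto
    moreover have f': "?f \<in> lhom R (sub_mod ?M I) (sub_mod ?M (?f ` I))"
      using f by (rule lhom_corestrict) simp
    moreover have "fin_gen R (ker_mod (sub_mod ?M I) (sub_mod ?M (?f ` I)) ?f)"
    proof -
      have "submodule (a_kernel (sub_mod ?M I) (sub_mod ?M (?f ` I)) ?f) R (sub_mod ?M I)"
        by (rule a_kernel_submodule[OF subI sub_mod_left_module[OF M im] f'])
      then have "submodule (a_kernel (sub_mod ?M I) (sub_mod ?M (?f ` I)) ?f) R ?M"
        "a_kernel (sub_mod ?M I) (sub_mod ?M (?f ` I)) ?f \<subseteq> I"
        by (simp_all add: sub_mod_submodule_iff[OF M I])
      moreover have "a_kernel (sub_mod ?M I) (sub_mod ?M (?f ` I)) ?f \<noteq> I"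
        using neg by (auto simp: a_kernel_def')
      ultimately show ?thesis
        unfolding ker_mod_def using min by simp
    qed
    ultimately have "fin_gen R (sub_mod ?M I)"
      by (intro fin_gen_extension[OF subI sub_mod_left_module[OF M im]]) auto
    then show False using not_fg by simp
  qed
  \<comment> \<open>The chain of ideals r^n R stabilizes, so r^m = r^(m+1) a for some m and a. Every
    y in I has the form r^m z with z in I, since r maps I onto itself; hence a r y = r^(m+1) a z =
    r^m z = y.\<close>
  have unit: "\<exists>a\<in>carrier R. \<forall>y\<in>I. a \<otimes> (r \<otimes> y) = y"
    if r: "r \<in> carrier R" "(\<lambda>x. r \<otimes> x) ` I = I" for r
  proof -
    have pow_onto: "(\<lambda>x. r [^] n \<otimes> x) ` I = I" for n :: nat
    proof (induction n)
      case 0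
      then show ?case using ID(7) by auto
    next
      case (Suc n)
      have "(\<lambda>x. r [^] Suc n \<otimes> x) ` I = (\<lambda>x. r [^] n \<otimes> x) ` (\<lambda>x. r \<otimes> x) ` I"
        unfolding image_image using ID(7) r(1) by (intro image_cong) (auto simp: m_assoc)
      then show ?case
        using Suc r(2) by simp
    qed
    let ?J = "\<lambda>n. (\<lambda>a. r [^] (n::nat) \<otimes> a) ` carrier R"
    have "submodule (?J n) R ?M" for n
      using lhom_image_submodule[OF M M _ M.submodule_carrier, of "\<lambda>x. r [^] n \<otimes> x"]
        smult_lhom[OF nat_pow_closed[OF r(1)] M.submodule_carrier, of n]
      by (simp add: sub_mod_simps(6)[of ?M, simplified])
    moreover have "?J (Suc n) \<subseteq> ?J n" for n
      using r(1) by (auto simp: m_assoc)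
    ultimately obtain m where "\<forall>n\<ge>m. ?J n = ?J m"
      using assms(2)[unfolded artinian_ring_def, THEN conjunct2, THEN spec[of _ ?J]] by auto
    then have "?J (Suc m) = ?J m" using le_SucI[OF order_refl] by blast
    moreover have "r [^] m \<in> ?J m"
      using r(1) by (intro image_eqI[of _ _ \<one>]) auto
    ultimately obtain a where a: "a \<in> carrier R" "r [^] m = r [^] Suc m \<otimes> a" by blast
    have "a \<otimes> (r \<otimes> y) = y" if "y \<in> I" for y
    proof -
      have "y \<in> (\<lambda>x. r [^] m \<otimes> x) ` I"
        using that unfolding pow_onto .
      then obtain z where z: "z \<in> I" "y = r [^] m \<otimes> z" by auto
      have zR: "z \<in> carrier R" using ID(7) z(1) by simp
      have "a \<otimes> (r \<otimes> y) = (r [^] Suc m \<otimes> a) \<otimes> z"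
        using a(1) r(1) zR unfolding z(2) by (simp add: m_ac)
      then show ?thesis
        unfolding a(2)[symmetric] z(2) .
    qed
    with a(1) show ?thesis by blast
  qed
  have "I \<noteq> {\<zero>}"
  proof
    assume "I = {\<zero>}"
    then have "?fg I"
      unfolding fin_gen_sub_mod_iff[OF M I]
      using M.submodD(2) by (intro exI[of _ "{}"]) auto
    then show False using not_fg by simp
  qed
  then obtain x where x: "x \<in> I" "x \<noteq> \<zero>"
    using ID(2) by auto
  let ?\<A> = "{H. submodule H R ?M \<and> H \<subseteq> I \<and> x \<notin> H}"
  \<comment> \<open>Avoiding x is preserved under unions of chains, so Zorn's lemma gives a maximal
    such H. It is proper in I, as x lies in I, and therefore finitely generated.\<close>
  have "\<exists>H\<in>?\<A>. \<forall>K\<in>?\<A>. H \<subseteq> K \<longrightarrow> K = H"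
  proof (rule subset_Zorn_nonempty)
    show "?\<A> \<noteq> {}"
      using M.submodule_zero x ID(2) by auto
    fix \<C> assume \<C>: "\<C> \<noteq> {}" "subset.chain ?\<A> \<C>"
    have sub: "\<And>H. H \<in> \<C> \<Longrightarrow> submodule H R ?M" "\<And>H. H \<in> \<C> \<Longrightarrow> H \<subseteq> I" "\<And>H. H \<in> \<C> \<Longrightarrow> x \<notin> H"
      and lin: "\<And>H K. H \<in> \<C> \<Longrightarrow> K \<in> \<C> \<Longrightarrow> H \<subseteq> K \<or> K \<subseteq> H"
      using \<C>(2) unfolding subset.chain_def by auto
    note D = M.submodD[OF sub(1), simplified]
    have "submodule (\<Union>\<C>) R ?M"
    proof (rule M.submodI)
      show "\<Union>\<C> \<subseteq> carrier ?M" using D(1) by auto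
      show "\<zero>\<^bsub>?M\<^esub> \<in> \<Union>\<C>" using D(2) \<C>(1) by auto
      show "a \<odot>\<^bsub>?M\<^esub> y \<in> \<Union>\<C>" if "a \<in> carrier R" "y \<in> \<Union>\<C>" for a y
        using D(4) that by auto
      show "y \<oplus>\<^bsub>?M\<^esub> z \<in> \<Union>\<C>" if yz: "y \<in> \<Union>\<C>" "z \<in> \<Union>\<C>" for y z
      proof -
        obtain H K where "H \<in> \<C>" "y \<in> H" "K \<in> \<C>" "z \<in> K" using yz by auto
        then obtain L where "L \<in> \<C>" "y \<in> L" "z \<in> L" using lin[of H K] by auto
        then show ?thesis using D(3)[of L y z] by auto
      qed
    qed
    then show "\<Union>\<C> \<in> ?\<A>" using sub by auto
  qed
  then obtain H where H: "submodule H R ?M" "H \<subseteq> I" "x \<notin> H"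
    and max: "\<And>K. submodule K R ?M \<Longrightarrow> K \<subseteq> I \<Longrightarrow> x \<notin> K \<Longrightarrow> H \<subseteq> K \<Longrightarrow> K = H"
    by auto
  note HD = M.submodD[OF H(1), simplified]
  have "?fg H"
    using x(1) H by (intro min) auto
  then obtain T where T: "finite T" "T \<subseteq> H" "\<And>U. submodule U R ?M \<Longrightarrow> T \<subseteq> U \<Longrightarrow> H \<subseteq> U"
    unfolding fin_gen_sub_mod_iff[OF M H(1)] by auto
  \<comment> \<open>For y outside H, maximality puts x into H + Ry, say x = h + ry. Here ry is
    nonzero, since x is not in H, so r maps I onto itself and is undone by some a. Then y = a(x - h)
    lies in every submodule containing x and H.\<close>
  have "I \<subseteq> U" if U: "submodule U R ?M" "insert x T \<subseteq> U" for U
  proof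
    fix y assume y: "y \<in> I"
    note UD = M.submodD[OF U(1), simplified]
    have HU: "H \<subseteq> U" and xU: "x \<in> U" using T(3)[OF U(1)] U(2) by auto
    show "y \<in> U"
    proof (cases "y \<in> H")
      case False
      have yR: "y \<in> carrier R" using ID(7) y by simp
      let ?K = "{h \<oplus> r \<otimes> y | h r. h \<in> H \<and> r \<in> carrier R}"
      have K: "submodule ?K R ?M"
      proof (rule M.submodI)
        show "?K \<subseteq> carrier ?M" using HD(7) yR by auto
        show "\<zero>\<^bsub>?M\<^esub> \<in> ?K" using HD(2) yR by (auto intro!: exI[of _ \<zero>])
        show "u \<oplus>\<^bsub>?M\<^esub> v \<in> ?K" if uv: "u \<in> ?K" "v \<in> ?K" for u v
        proof -
          obtain h r h' r' where *: "u = h \<oplus> r \<otimes> y" "h \<in> H" "r \<in> carrier R"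
            "v = h' \<oplus> r' \<otimes> y" "h' \<in> H" "r' \<in> carrier R" using uv by blast
          then have "u \<oplus> v = (h \<oplus> h') \<oplus> (r \<oplus> r') \<otimes> y"
            using HD(7) yR by (simp add: l_distr a_ac)
          moreover have "h \<oplus> h' \<in> H" "r \<oplus> r' \<in> carrier R" using * HD(3) by auto
          ultimately show ?thesis by auto
        qed
        show "a \<odot>\<^bsub>?M\<^esub> u \<in> ?K" if a: "a \<in> carrier R" and u: "u \<in> ?K" for a u
        proof -
          obtain h r where *: "u = h \<oplus> r \<otimes> y" "h \<in> H" "r \<in> carrier R" using u by blast
          then have "a \<otimes> u = a \<otimes> h \<oplus> (a \<otimes> r) \<otimes> y"
            using HD(7) yR a by (simp add: r_distr m_assoc)
          moreover have "a \<otimes> h \<in> H" "a \<otimes> r \<in> carrier R" using * HD(4) a by auto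
          ultimately show ?thesis by auto
        qed
      qed
      have HK: "H \<subseteq> ?K"
      proof
        fix h assume h: "h \<in> H"
        then have "h = h \<oplus> \<zero> \<otimes> y" using HD(7) yR by simp
        then show "h \<in> ?K" using h by blast
      qed
      have "y = \<zero> \<oplus> \<one> \<otimes> y" using yR by simp
      then have "y \<in> ?K" using HD(2) by blast
      moreover have "?K \<subseteq> I" using ID(3,4) H(2) y by auto
      ultimately have "x \<in> ?K" using max[OF K _ _ HK] False by auto
      then obtain h r where hr: "x = h \<oplus> r \<otimes> y" "h \<in> H" "r \<in> carrier R" by blast
      have "r \<otimes> y \<noteq> \<zero>"
        using hr HD(7)[OF hr(2)] H(3) by auto
      then have "(\<lambda>x. r \<otimes> x) ` I = I" using dich[OF hr(3)] y by blast
      then obtain a where a: "a \<in> carrier R" "a \<otimes> (r \<otimes> y) = y" using unit[OF hr(3)] y by blast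
      have hR: "h \<in> carrier R" using HD(7)[OF hr(2)] .
      have "r \<otimes> y = (\<ominus> \<one>) \<otimes> h \<oplus> x"
        unfolding hr(1) using hr(3) hR yR by (simp add: l_minus r_neg1)
      moreover have "(\<ominus> \<one>) \<otimes> h \<oplus> x \<in> U"
        using UD(3)[OF UD(4)[of "\<ominus> \<one>" h] xU] HU hr(2) by auto
      ultimately show "y \<in> U"
        using UD(4)[OF a(1), of "r \<otimes> y"] a(2) by simp
    qed (use HU in auto)
  qed
  then have "?fg I"
    unfolding fin_gen_sub_mod_iff[OF M I] using T(1,2) H(2) x(1)
    by (intro exI[of _ "insert x T"]) auto
  then show False using not_fg by simp
qed

text \<open>As cx = (c1)x for a scalar c of k, left ideals of \<Lambda> are k-submodules of
  \<Lambda>, which is finitely generated over the Noetherian ring k. A finite set generating a left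
  ideal over k generates it over \<Lambda> too, because every left ideal containing it is a
  k-submodule.\<close>

lemma artin_algebra_noetherian:
  fixes k :: "('k, 'r) ring_scheme" and \<Lambda> :: "('k, 'a) module"
  assumes "artin_algebra k \<Lambda>"
  shows "noetherian_module \<Lambda> (regular \<Lambda>)"
proof -
  interpret artin_algebra k \<Lambda> by fact
  interpret L: left_module k \<Lambda>
    by (intro left_module.intro left_module_axioms.intro R.ring_axioms M.abelian_group_axioms)
      (auto simp: smult_l_distr smult_r_distr smult_assoc1)
  have reg: "left_module \<Lambda> (regular \<Lambda>)"
    by (rule regular_left_module) (rule ring_axioms)
  interpret reg: left_module \<Lambda> "regular \<Lambda>" by (fact reg)
  have sub_k: "submodule I k \<Lambda>" if "submodule I \<Lambda> (regular \<Lambda>)" for I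
  proof (rule L.submodI)
    note D = reg.submodD[OF that, simplified]
    show "I \<subseteq> carrier \<Lambda>" "\<zero>\<^bsub>\<Lambda>\<^esub> \<in> I" "\<And>x y. x \<in> I \<Longrightarrow> y \<in> I \<Longrightarrow> x \<oplus>\<^bsub>\<Lambda>\<^esub> y \<in> I"
      by (fact D)+
    show "c \<odot>\<^bsub>\<Lambda>\<^esub> x \<in> I" if c: "c \<in> carrier k" and x: "x \<in> I" for c x
    proof -
      have "(c \<odot>\<^bsub>\<Lambda>\<^esub> \<one>\<^bsub>\<Lambda>\<^esub>) \<otimes>\<^bsub>\<Lambda>\<^esub> x = c \<odot>\<^bsub>\<Lambda>\<^esub> x"
        using smult_mult_l[OF c _ D(7)[OF x]] D(7)[OF x] by simp
      then show ?thesis using D(4)[of "c \<odot>\<^bsub>\<Lambda>\<^esub> \<one>\<^bsub>\<Lambda>\<^esub>" x] c x by simp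
    qed
  qed
  have noeth: "noetherian_module k \<Lambda>"
    using artinian_imp_noetherian[OF R.cring_axioms artinian]
    by (rule fin_gen_imp_noetherian[OF L.left_module_axioms fin_gen])
  show ?thesis
    unfolding noetherian_module_def
  proof (intro allI impI)
    fix I assume I: "submodule I \<Lambda> (regular \<Lambda>)"
    then have "fin_gen k (sub_mod \<Lambda> I)"
      using noeth sub_k unfolding noetherian_module_def by blast
    then show "fin_gen \<Lambda> (sub_mod (regular \<Lambda>) I)"
      unfolding fin_gen_sub_mod_iff[OF L.left_module_axioms sub_k[OF I]] fin_gen_sub_mod_iff[OF reg I]
      using sub_k by meson
  qed
qed

subsection \<open>Projective modules\<close>

lemma fg_moduleD:
  assumes "fg_module R M" shows "left_module R M" "fin_gen R M"
  using assms by (auto simp: fg_module_def)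

lemma fg_module_image:
  assumes "fg_module R M" "left_module R K" "f \<in> lhom R M K" "f ` carrier M = carrier K"
  shows "fg_module R K"
  using assms fin_gen_image unfolding fg_module_def by blast

text \<open>The types of A and B are arbitrary here, unlike in \<open>projective_module\<close>. A
  finite generating set S makes P a retract of R^S; maps out of R^S are lifted by choosing preimages
  for the generators, and the lift is pulled back along the section.\<close>

lemma projective_lift:
  fixes P :: "('a, 'p) module" and A :: "('a, 'm) module" and B :: "('a, 'n) module"
  assumes "projective_module R P" "fin_gen R P" and A: "left_module R A" and B: "left_module R B"
    and g: "g \<in> lhom R A B" "g ` carrier A = carrier B" and f: "f \<in> lhom R P B"
  shows "\<exists>h\<in>lhom R P A. \<forall>x\<in>carrier P. g (h x) = f x"
proof -
  have P: "left_module R P"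
    using assms(1) by (simp add: projective_module_def)
  interpret P: left_module R P by fact
  interpret B: left_module R B by fact
  obtain S where S: "finite S" "S \<subseteq> carrier P" "lspan R P S = carrier P"
    using assms(2) unfolding fin_gen_def by blast
  let ?F = "free_module R S :: ('a, 'p \<Rightarrow> 'a) module" and ?e = "lin_comb P S (\<lambda>s. s)"
  have F: "left_module R ?F"
    by (rule free_module_left_module[OF P.R.ring_axioms])
  have mem: "(\<lambda>s. s) \<in> S \<rightarrow> carrier P" using S(2) by auto
  have e: "?e \<in> lhom R ?F P" "?e ` carrier ?F = carrier P"
    using lin_comb_lhom[OF P S(1) mem] lin_comb_surj[OF P S(1) mem] S(3) by auto
  \<comment> \<open>The definition is applied once, to the epimorphism R^S \<rightarrow> P and the
    identity of P, whose types match the tested ones.\<close>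
  obtain \<sigma> where \<sigma>: "\<sigma> \<in> lhom R P ?F" "\<And>x. x \<in> carrier P \<Longrightarrow> ?e (\<sigma> x) = x"
    using assms(1)[unfolded projective_module_def, THEN conjunct2, rule_format, of ?F P ?e "\<lambda>x. x"]
      F P e lhom_ident by blast
  have "\<forall>s\<in>S. \<exists>a\<in>carrier A. g a = f s"
  proof
    fix s assume "s \<in> S"
    then have "f s \<in> g ` carrier A"
      using lhomD(1)[OF f] S(2) unfolding g(2) by auto
    then show "\<exists>a\<in>carrier A. g a = f s" by auto
  qed
  then obtain a where a: "\<And>s. s \<in> S \<Longrightarrow> a s \<in> carrier A" "\<And>s. s \<in> S \<Longrightarrow> g (a s) = f s"
    by metis
  have aS: "a \<in> S \<rightarrow> carrier A" using a(1) by auto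
  show ?thesis
  proof (intro bexI ballI)
    show "(\<lambda>x. lin_comb A S a (\<sigma> x)) \<in> lhom R P A"
      by (rule lhom_comp[OF \<sigma>(1) lin_comb_lhom[OF A S(1) aS]])
    fix x assume x: "x \<in> carrier P"
    note \<sigma>x = lhomD(1)[OF \<sigma>(1) x]
    have "g (lin_comb A S a (\<sigma> x)) = lin_comb B S (\<lambda>s. g (a s)) (\<sigma> x)"
      by (rule lin_comb_image[OF A B g(1) S(1) aS \<sigma>x])
    also have "\<dots> = lin_comb B S (\<lambda>s. f s) (\<sigma> x)"
      unfolding lin_comb_def using a(2) S(2) lhomD(1)[OF f] free_module_closed[OF P.R.ring_axioms \<sigma>x]
      by (intro B.M.finsum_cong') (auto simp: B.smult_closed subset_iff)
    also have "\<dots> = f (?e (\<sigma> x))"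
      by (rule lin_comb_image[OF P B f S(1) mem \<sigma>x, symmetric])
    finally show "g (lin_comb A S a (\<sigma> x)) = f x"
      using \<sigma>(2)[OF x] by simp
  qed
qed

text \<open>A map f out of Q is lifted by lifting f u out of P and composing with v. As P and Q may
  have different types, this also transports projectivity along isomorphisms between types.\<close>

lemma retract_projective:
  fixes P :: "('a, 'p) module" and Q :: "('a, 'q) module"
  assumes P: "fg_module R P" "projective_module R P" and Q: "left_module R Q"
    and u: "u \<in> lhom R P Q" and v: "v \<in> lhom R Q P" and uv: "\<And>x. x \<in> carrier Q \<Longrightarrow> u (v x) = x"
  shows "fg_module R Q" "projective_module R Q"
proof -
  have "u ` carrier P = carrier Q"
  proof
    show "carrier Q \<subseteq> u ` carrier P"
      using uv lhomD(1)[OF v] by (metis image_iff subsetI)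
  qed (use lhomD(1)[OF u] in auto)
  then show "fg_module R Q"
    by (rule fg_module_image[OF P(1) Q u])
  show "projective_module R Q"
    unfolding projective_module_def
  proof (intro conjI allI impI Q; elim conjE)
    fix A :: "('a, 'q \<Rightarrow> 'a) module" and B :: "('a, 'q) module" and g f
    assume *: "left_module R A" "left_module R B" "g \<in> lhom R A B" "g ` carrier A = carrier B"
      "f \<in> lhom R Q B"
    obtain h where h: "h \<in> lhom R P A" "\<And>x. x \<in> carrier P \<Longrightarrow> g (h x) = f (u x)"
      using projective_lift[OF P(2) fg_moduleD(2)[OF P(1)] *(1-4) lhom_comp[OF u *(5)]] by blast
    show "\<exists>h\<in>lhom R Q A. \<forall>x\<in>carrier Q. g (h x) = f x"
      using lhom_comp[OF v h(1)] h(2)[OF lhomD(1)[OF v]] uv by (intro bexI[of _ "\<lambda>x. h (v x)"]) auto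
  qed
qed

text \<open>The map x - v(u x) is the projection of P onto the kernel of u along the image of v, so
  the kernel is a retract of P.\<close>

lemma split_kernel_projective:
  assumes P: "fg_module R P" "projective_module R P" and K: "left_module R K"
    and u: "u \<in> lhom R P K" and v: "v \<in> lhom R K P" and uv: "\<And>x. x \<in> carrier K \<Longrightarrow> u (v x) = x"
  shows "(\<lambda>x. x \<ominus>\<^bsub>P\<^esub> v (u x)) \<in> lhom R P (ker_mod P K u)"
    and "\<And>x. x \<in> a_kernel P K u \<Longrightarrow> x \<ominus>\<^bsub>P\<^esub> v (u x) = x"
    and "fg_module R (ker_mod P K u)" "projective_module R (ker_mod P K u)"
proof -
  note LP = fg_moduleD(1)[OF P(1)]
  interpret P: left_module R P by fact
  interpret K: left_module R K by fact
  note vu = lhom_comp[OF u v]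
  have diff: "(\<lambda>x. x \<ominus>\<^bsub>P\<^esub> v (u x)) \<in> lhom R P P"
    by (rule lhom_diff[OF LP LP lhom_ident vu])
  show r: "(\<lambda>x. x \<ominus>\<^bsub>P\<^esub> v (u x)) \<in> lhom R P (ker_mod P K u)"
    unfolding ker_mod_def
  proof (rule lhom_corestrict[OF diff])
    fix x assume x: "x \<in> carrier P"
    then show "x \<ominus>\<^bsub>P\<^esub> v (u x) \<in> a_kernel P K u"
      using lhomD(1)[OF diff x] lhomD(1)[OF u x] lhomD(1)[OF vu x]
      by (simp add: a_kernel_def' lhom_minus[OF LP K u] uv K.minus_self)
  qed
  show e: "x \<ominus>\<^bsub>P\<^esub> v (u x) = x" if "x \<in> a_kernel P K u" for x
    using that lhom_zero[OF K LP v] by (simp add: a_kernel_def' a_minus_def)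
  have incl: "(\<lambda>x. x) \<in> lhom R (ker_mod P K u) P"
    unfolding ker_mod_def by (rule lhom_incl) (auto simp: a_kernel_def')
  note ker = ker_mod_left_module[OF LP K u]
  show "fg_module R (ker_mod P K u)" "projective_module R (ker_mod P K u)"
    using retract_projective[OF P ker r incl] e by auto
qed

text \<open>P embeds as a direct summand of some R^n, and its image there is an isomorphic copy on a
  type that does not depend on \<open>'p\<close>.\<close>

lemma projective_on_nat_functions:
  fixes P :: "('a, 'p) module"
  assumes P: "fg_module R P" "projective_module R P"
  obtains Q :: "('a, nat \<Rightarrow> 'a) module" and \<sigma> \<tau> where "fg_module R Q" "projective_module R Q"
    and "\<sigma> \<in> lhom R P Q" "\<tau> \<in> lhom R Q P" "\<And>x. x \<in> carrier P \<Longrightarrow> \<tau> (\<sigma> x) = x"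
    and "\<And>x. x \<in> carrier Q \<Longrightarrow> \<sigma> (\<tau> x) = x"
proof -
  note LP = fg_moduleD[OF P(1)]
  interpret P: left_module R P by (rule LP)
  obtain n b where b: "b \<in> {..<n::nat} \<rightarrow> carrier P"
    "lin_comb P {..<n} b ` carrier (free_module R {..<n}) = carrier P"
    using free_module_cover[OF LP] .
  let ?F = "free_module R {..<n}" and ?t = "lin_comb P {..<n} b"
  have F: "left_module R ?F"
    by (rule free_module_left_module[OF P.R.ring_axioms])
  have t: "?t \<in> lhom R ?F P"
    by (rule lin_comb_lhom[OF LP(1) _ b(1)]) simp
  obtain \<sigma> where \<sigma>: "\<sigma> \<in> lhom R P ?F" "\<And>x. x \<in> carrier P \<Longrightarrow> ?t (\<sigma> x) = x"
    using projective_lift[OF P(2) LP(2) F LP(1) t b(2) lhom_ident] by blast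
  note im = lhom_image_submodule[OF LP(1) F \<sigma>(1) P.submodule_carrier]
  let ?Q = "sub_mod ?F (\<sigma> ` carrier P)"
  have Q: "left_module R ?Q"
    by (rule sub_mod_left_module[OF F im])
  have \<sigma>': "\<sigma> \<in> lhom R P ?Q"
    by (rule lhom_corestrict[OF \<sigma>(1)]) simp
  have t': "?t \<in> lhom R ?Q P"
    by (rule lhom_restrict[OF t left_module.submodD(1)[OF F im]])
  have \<sigma>t: "\<sigma> (?t x) = x" if "x \<in> carrier ?Q" for x
    using that \<sigma>(2) by auto
  show ?thesis
    using that[OF retract_projective[OF P Q \<sigma>' t' \<sigma>t] \<sigma>' t' \<sigma>(2) \<sigma>t] by simp
qed

section \<open>Direct sums of two modules\<close>

lemma mod_sum_simps [simp]:
  "carrier (mod_sum M N) = carrier M \<times> carrier N" "ring.zero (mod_sum M N) = (\<zero>\<^bsub>M\<^esub>, \<zero>\<^bsub>N\<^esub>)"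
  "ring.add (mod_sum M N) = (\<lambda>(x, y) (x', y'). (x \<oplus>\<^bsub>M\<^esub> x', y \<oplus>\<^bsub>N\<^esub> y'))"
  "module.smult (mod_sum M N) = (\<lambda>a (x, y). (a \<odot>\<^bsub>M\<^esub> x, a \<odot>\<^bsub>N\<^esub> y))"
  by (simp_all add: mod_sum_def)

lemma mod_sum_left_module:
  assumes "left_module R M" "left_module R N"
  shows "left_module R (mod_sum M N)"
proof -
  interpret M: left_module R M by fact
  interpret N: left_module R N by fact
  show ?thesis
    by (intro left_moduleI)
      (auto simp: M.R.ring_axioms M.M.a_ac N.M.a_ac M.smult_closed N.smult_closed
        M.smult_l_distr N.smult_l_distr M.smult_r_distr N.smult_r_distr
        M.smult_assoc1 N.smult_assoc1 M.smult_one N.smult_one)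
qed

lemma mod_sum_lhom:
  "fst \<in> lhom R (mod_sum M N) M" "snd \<in> lhom R (mod_sum M N) N"
  by (auto intro!: lhomI)

lemma mod_sum_inl:
  assumes "left_module R N"
  shows "(\<lambda>x. (x, \<zero>\<^bsub>N\<^esub>)) \<in> lhom R M (mod_sum M N)"
proof -
  interpret N: left_module R N by fact
  show ?thesis by (intro lhomI) auto
qed

lemma mod_sum_inr:
  assumes "left_module R M"
  shows "(\<lambda>y. (\<zero>\<^bsub>M\<^esub>, y)) \<in> lhom R N (mod_sum M N)"
proof -
  interpret M: left_module R M by fact
  show ?thesis by (intro lhomI) auto
qed

lemma mod_sum_pair:
  assumes "f \<in> lhom R K M" "g \<in> lhom R K N"
  shows "(\<lambda>x. (f x, g x)) \<in> lhom R K (mod_sum M N)"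
  using lhomD[OF assms(1)] lhomD[OF assms(2)] by (intro lhomI) auto

lemma mod_sum_copair:
  assumes "left_module R K" "f \<in> lhom R M K" "g \<in> lhom R N K"
  shows "(\<lambda>z. f (fst z) \<oplus>\<^bsub>K\<^esub> g (snd z)) \<in> lhom R (mod_sum M N) K"
  by (intro lhom_add[OF assms(1)] lhom_comp[OF mod_sum_lhom(1) assms(2)]
      lhom_comp[OF mod_sum_lhom(2) assms(3)])

text \<open>The sum is an extension of N by the kernel of \<open>snd\<close>, which is the image of
  M under the first inclusion.\<close>

lemma mod_sum_fg:
  assumes M: "fg_module R M" and N: "fg_module R N"
  shows "fg_module R (mod_sum M N)"
proof -
  note LM = fg_moduleD[OF M] and LN = fg_moduleD[OF N]
  interpret M: left_module R M by (rule LM)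
  interpret N: left_module R N by (rule LN)
  note S = mod_sum_left_module[OF LM(1) LN(1)]
  note ker = ker_mod_left_module[OF S LN(1) mod_sum_lhom(2)]
  have "(\<lambda>x. (x, \<zero>\<^bsub>N\<^esub>)) \<in> lhom R M (ker_mod (mod_sum M N) N snd)"
    unfolding ker_mod_def by (intro lhom_corestrict mod_sum_inl LN) (auto simp: a_kernel_def')
  then have "fin_gen R (ker_mod (mod_sum M N) N snd)"
    by (rule fin_gen_image[OF LM(1) ker _ _ LM(2)]) (auto simp: a_kernel_def')
  moreover have "snd ` carrier (mod_sum M N) = carrier N"
    using M.M.zero_closed by force
  ultimately show ?thesis
    using fin_gen_extension[OF S LN(1) mod_sum_lhom(2) _ LN(2)] S unfolding fg_module_def by blast
qed

text \<open>Lifts on the two summands are added. The test modules live on types built from pairs, so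
  the lift on each summand has to come from \<open>projective_lift\<close>.\<close>

lemma mod_sum_projective:
  fixes M :: "('a, 'm) module" and N :: "('a, 'n) module"
  assumes M: "fg_module R M" "projective_module R M" and N: "fg_module R N" "projective_module R N"
  shows "projective_module R (mod_sum M N)"
  unfolding projective_module_def
proof (intro conjI allI impI mod_sum_left_module fg_moduleD(1)[OF M(1)] fg_moduleD(1)[OF N(1)];
    elim conjE)
  note LM = fg_moduleD[OF M(1)] and LN = fg_moduleD[OF N(1)]
  interpret M: left_module R M by (rule LM)
  interpret N: left_module R N by (rule LN)
  fix A :: "('a, 'm \<times> 'n \<Rightarrow> 'a) module" and B :: "('a, 'm \<times> 'n) module" and g f
  assume A: "left_module R A" and B: "left_module R B" and g: "g \<in> lhom R A B"
    "g ` carrier A = carrier B" and f: "f \<in> lhom R (mod_sum M N) B"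
  obtain h1 where h1: "h1 \<in> lhom R M A" "\<And>x. x \<in> carrier M \<Longrightarrow> g (h1 x) = f (x, \<zero>\<^bsub>N\<^esub>)"
    using projective_lift[OF M(2) LM(2) A B g lhom_comp[OF mod_sum_inl[OF LN(1)] f]] by blast
  obtain h2 where h2: "h2 \<in> lhom R N A" "\<And>x. x \<in> carrier N \<Longrightarrow> g (h2 x) = f (\<zero>\<^bsub>M\<^esub>, x)"
    using projective_lift[OF N(2) LN(2) A B g lhom_comp[OF mod_sum_inr[OF LM(1)] f]] by blast
  have "g (h1 x \<oplus>\<^bsub>A\<^esub> h2 y) = f (x, y)" if "x \<in> carrier M" "y \<in> carrier N" for x y
    using that lhomD(1)[OF h1(1)] lhomD(1)[OF h2(1)] lhomD(2)[OF f, of "(x, \<zero>\<^bsub>N\<^esub>)" "(\<zero>\<^bsub>M\<^esub>, y)"]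
    by (simp add: lhomD(2)[OF g(1)] h1(2) h2(2))
  then show "\<exists>h\<in>lhom R (mod_sum M N) A. \<forall>x\<in>carrier (mod_sum M N). g (h x) = f x"
    using mod_sum_copair[OF A h1(1) h2(1)] by (intro bexI) auto
qed

text \<open>
  The kernel of \<open>p\<close> being superfluous, a lift of \<open>q\<close> along \<open>p\<close> is onto, and so splits.
\<close>

lemma projective_cover_retract:
  assumes cover: "projective_cover R B p M"
    and A: "fg_module R A" "projective_module R A" and q: "q \<in> lhom R A M" "q ` carrier A = carrier M"
  obtains u v where "u \<in> lhom R A B" "v \<in> lhom R B A" "\<And>x. x \<in> carrier B \<Longrightarrow> u (v x) = x"
    "\<And>x. x \<in> carrier A \<Longrightarrow> p (u x) = q x" "\<And>x. x \<in> carrier B \<Longrightarrow> q (v x) = p x"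
proof -
  have B: "fg_module R B" "projective_module R B" and M: "left_module R M"
    and p: "p \<in> lhom R B M" "p ` carrier B = carrier M"
    and superfluous: "\<And>U. submodule U R B \<Longrightarrow> set_add B U (a_kernel B M p) = carrier B \<Longrightarrow> U = carrier B"
    using cover unfolding projective_cover_def fg_module_def by auto
  note LA = fg_moduleD[OF A(1)] and LB = fg_moduleD[OF B(1)]
  interpret A: left_module R A by (rule LA)
  interpret B: left_module R B by (rule LB)
  interpret M: left_module R M by (rule M)
  obtain u where u: "u \<in> lhom R A B" "\<And>x. x \<in> carrier A \<Longrightarrow> p (u x) = q x"
    using projective_lift[OF A(2) LA(2) LB(1) M p q(1)] by blast
  have im: "submodule (u ` carrier A) R B"
    by (rule lhom_image_submodule[OF LA(1) LB(1) u(1) A.submodule_carrier])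
  \<comment> \<open>As q is onto, p x = q a = p(u a) for some a, and x differs from u a by an
    element of the kernel of p.\<close>
  have "set_add B (u ` carrier A) (a_kernel B M p) = carrier B"
  proof
    show "set_add B (u ` carrier A) (a_kernel B M p) \<subseteq> carrier B"
      using lhomD(1)[OF u(1)] by (auto simp: set_add_def' a_kernel_def')
    show "carrier B \<subseteq> set_add B (u ` carrier A) (a_kernel B M p)"
    proof
      fix x assume x: "x \<in> carrier B"
      then have "p x \<in> q ` carrier A"
        using lhomD(1)[OF p(1)] unfolding q(2) by simp
      then obtain a where a: "a \<in> carrier A" "p x = q a" by auto
      note ua = lhomD(1)[OF u(1) a(1)]
      have "x \<ominus>\<^bsub>B\<^esub> u a \<in> a_kernel B M p"
        using x ua a u(2)[OF a(1)] lhomD(1)[OF p(1) x] lhomD(1)[OF q(1) a(1)]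
        by (simp add: a_kernel_def' lhom_minus[OF LB(1) M p(1)] M.minus_self)
      moreover have "x = u a \<oplus>\<^bsub>B\<^esub> (x \<ominus>\<^bsub>B\<^esub> u a)"
        using x ua by (simp add: B.add_minus_cancel)
      ultimately show "x \<in> set_add B (u ` carrier A) (a_kernel B M p)"
        using a(1) unfolding set_add_def' by blast
    qed
  qed
  then have surj: "u ` carrier A = carrier B"
    by (rule superfluous[OF im])
  \<comment> \<open>The section lifts the identity of the projective module B along u; then q v = p
    u v = p.\<close>
  obtain v where v: "v \<in> lhom R B A" "\<And>x. x \<in> carrier B \<Longrightarrow> u (v x) = x"
    using projective_lift[OF B(2) LB(2) LA(1) LB(1) u(1) surj lhom_ident] by blast
  show ?thesis
    using that[OF u(1) v(1,2) u(2)] u(2)[OF lhomD(1)[OF v(1)]] v(2) by simp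
qed

subsection \<open>Quotients, socle and radical\<close>

lemma quot_mod_simps [simp]:
  "carrier (quot_mod M N) = a_rcosets\<^bsub>M\<^esub> N" "ring.zero (quot_mod M N) = N"
  "ring.add (quot_mod M N) = set_add M"
  "module.smult (quot_mod M N) = (\<lambda>a U. \<Union>x\<in>U. N +>\<^bsub>M\<^esub> (a \<odot>\<^bsub>M\<^esub> x))"
  by (simp_all add: quot_mod_def)

lemma quot_mod_proj:
  assumes "left_module R M" "submodule N R M"
  shows "(\<lambda>x. N +>\<^bsub>M\<^esub> x) \<in> lhom R M (quot_mod M N)"
    and "(\<lambda>x. N +>\<^bsub>M\<^esub> x) ` carrier M = carrier (quot_mod M N)"
    and "a_kernel M (quot_mod M N) (\<lambda>x. N +>\<^bsub>M\<^esub> x) = N"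
proof -
  interpret left_module R M by fact
  note N = submodD[OF assms(2)]
  have sg: "subgroup N (add_monoid M)"
    using assms(2) by (rule submodule.axioms(1))
  interpret N: abelian_subgroup N M
    by (intro abelian_subgroupI3 additive_subgroupI sg M.abelian_group_axioms)
  show "(\<lambda>x. N +>\<^bsub>M\<^esub> x) \<in> lhom R M (quot_mod M N)"
  proof (rule lhomI)
    fix a x assume a: "a \<in> carrier R" and x: "x \<in> carrier M"
    \<comment> \<open>The action on cosets is a union over all representatives. It is a single coset
      because every representative y contributes the same one and x itself is a
      representative.\<close>
    have "N +>\<^bsub>M\<^esub> (a \<odot>\<^bsub>M\<^esub> y) = N +>\<^bsub>M\<^esub> (a \<odot>\<^bsub>M\<^esub> x)" if y: "y \<in> N +>\<^bsub>M\<^esub> x" for y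
    proof -
      obtain h where h: "h \<in> N" "y = h \<oplus>\<^bsub>M\<^esub> x"
        using y by (auto simp: a_r_coset_def')
      have "a \<odot>\<^bsub>M\<^esub> y = a \<odot>\<^bsub>M\<^esub> h \<oplus>\<^bsub>M\<^esub> a \<odot>\<^bsub>M\<^esub> x"
        using a x N(7)[OF h(1)] by (simp add: h(2) smult_r_distr)
      then have "a \<odot>\<^bsub>M\<^esub> y \<in> N +>\<^bsub>M\<^esub> (a \<odot>\<^bsub>M\<^esub> x)"
        using M.a_rcosI[OF N(4)[OF a h(1)] N(1) smult_closed[OF a x]] by simp
      then show ?thesis
        using M.a_repr_independence[OF _ smult_closed[OF a x] sg] by simp
    qed
    moreover have "x \<in> N +>\<^bsub>M\<^esub> x"
      by (rule N.a_rcos_self[OF x])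
    ultimately have "(\<Union>y\<in>N +>\<^bsub>M\<^esub> x. N +>\<^bsub>M\<^esub> (a \<odot>\<^bsub>M\<^esub> y)) = N +>\<^bsub>M\<^esub> (a \<odot>\<^bsub>M\<^esub> x)" by blast
    then show "N +>\<^bsub>M\<^esub> (a \<odot>\<^bsub>M\<^esub> x) = a \<odot>\<^bsub>quot_mod M N\<^esub> (N +>\<^bsub>M\<^esub> x)" by simp
  qed (simp_all add: M.a_rcosetsI[OF N(1)] N.a_rcos_sum)
  show "(\<lambda>x. N +>\<^bsub>M\<^esub> x) ` carrier M = carrier (quot_mod M N)"
    by (auto simp: A_RCOSETS_def')
  show "a_kernel M (quot_mod M N) (\<lambda>x. N +>\<^bsub>M\<^esub> x) = N"
    using N(7) M.a_coset_join1[OF _ _ sg] M.a_coset_join2[OF _ sg] by (auto simp: a_kernel_def')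
qed

lemma soc_submodule:
  assumes "left_module R M" shows "submodule (soc R M) R M"
proof -
  interpret left_module R M by fact
  show ?thesis
    unfolding soc_def simple_submodule_def
    by (intro lspan_submodule Union_least submodD(1)) simp
qed

lemma mrad_submodule:
  assumes "left_module R M" shows "submodule (mrad R M) R M"
proof -
  interpret left_module R M by fact
  show ?thesis
    unfolding mrad_def by (rule submodule_Inter) (simp add: maximal_submodule_def)
qed

text \<open>The projection onto the top is onto and \<phi> is onto the socle. The second claim
  becomes exactness at \<nu>P, the socle being the kernel of the projection to the quotient.\<close>

lemma alpha_map_lhom:
  assumes P: "left_module R P" and N: "left_module R N"
    and \<phi>: "\<phi> \<in> liso R (top_mod R P) (sub_mod N (soc R N))"
  shows "alpha_map R P \<phi> \<in> lhom R P N" and "alpha_map R P \<phi> ` carrier P = soc R N"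
proof -
  note q = quot_mod_proj[OF P mrad_submodule[OF P]]
  have \<phi>': "\<phi> \<in> lhom R (quot_mod P (mrad R P)) N"
    "\<phi> ` carrier (quot_mod P (mrad R P)) = soc R N"
    using \<phi> left_module.submodD(1)[OF N soc_submodule[OF N]] lhom_sub_modD
    unfolding liso_def top_mod_def bij_betw_def by fastforce+
  show "alpha_map R P \<phi> \<in> lhom R P N"
    unfolding alpha_map_def by (rule lhom_comp[OF q(1) \<phi>'(1)])
  show "alpha_map R P \<phi> ` carrier P = soc R N"
    unfolding \<phi>'(2)[symmetric] q(2)[symmetric] alpha_map_def by (simp add: image_image)
qed

subsection \<open>The exact sequence\<close>

text \<open>The comparison of two projective presentations of M in Schanuel's lemma. Minimality
  gives a retraction u of A onto B with p u = q and a section v with q v = p; then ker q is the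
  direct sum of v(ker p) and ker u. The latter is projective, and Q is a copy of it. The isomorphism
  is recorded as the mutually inverse maps m and n.\<close>

lemma kernel_of_projective_epi:
  assumes cover: "projective_cover R B p M"
    and A: "fg_module R A" "projective_module R A" and q: "q \<in> lhom R A M" "q ` carrier A = carrier M"
  obtains Q :: "('a, nat \<Rightarrow> 'a) module" and m n where "fg_module R Q" "projective_module R Q"
    and "m \<in> lhom R (mod_sum (ker_mod B M p) Q) (ker_mod A M q)"
    and "n \<in> lhom R (ker_mod A M q) (mod_sum (ker_mod B M p) Q)"
    and "\<And>x. x \<in> carrier (mod_sum (ker_mod B M p) Q) \<Longrightarrow> n (m x) = x"
    and "\<And>x. x \<in> carrier (ker_mod A M q) \<Longrightarrow> m (n x) = x"
proof -
  have LB: "left_module R B" and LM: "left_module R M" and p: "p \<in> lhom R B M"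
    using cover unfolding projective_cover_def fg_module_def by auto
  note LA = fg_moduleD(1)[OF A(1)]
  interpret A: left_module R A by (rule LA)
  interpret B: left_module R B by (rule LB)
  obtain u v where u: "u \<in> lhom R A B" and v: "v \<in> lhom R B A"
    and uv: "\<And>x. x \<in> carrier B \<Longrightarrow> u (v x) = x"
    and pu: "\<And>x. x \<in> carrier A \<Longrightarrow> p (u x) = q x" and qv: "\<And>x. x \<in> carrier B \<Longrightarrow> q (v x) = p x"
    using projective_cover_retract[OF cover A q] by blast
  let ?K = "ker_mod A B u" and ?S = "ker_mod B M p" and ?W = "ker_mod A M q"
  note K = split_kernel_projective[OF A LB u v uv]
  note LK = fg_moduleD(1)[OF K(3)]
  obtain Q :: "('a, nat \<Rightarrow> 'a) module" and \<sigma> \<tau> where Q: "fg_module R Q" "projective_module R Q"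
    and \<sigma>: "\<sigma> \<in> lhom R ?K Q" and \<tau>: "\<tau> \<in> lhom R Q ?K"
    and \<tau>\<sigma>: "\<And>x. x \<in> carrier ?K \<Longrightarrow> \<tau> (\<sigma> x) = x" and \<sigma>\<tau>: "\<And>x. x \<in> carrier Q \<Longrightarrow> \<sigma> (\<tau> x) = x"
    using projective_on_nat_functions[OF K(3,4)] by metis
  note kerS = a_kernel_submodule[OF LB LM p]
  note S = left_module.submodD(1)[OF LB kerS]
  note W = a_kernel_submodule[OF LA LM q(1)]
  have \<tau>': "\<tau> \<in> lhom R Q A"
    using lhom_sub_modD[OF \<tau>[unfolded ker_mod_def]] by (auto simp: a_kernel_def')
  have v': "v \<in> lhom R ?S A"
    unfolding ker_mod_def by (rule lhom_restrict[OF v S])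
  \<comment> \<open>\<open>?n\<close> splits x into v(u x), recorded by u x, and x - v(u x) in ker
    u; \<open>?m\<close> adds the two parts again. The maps \<sigma> and \<tau> identify ker u with
    Q.\<close>
  let ?m = "\<lambda>z. v (fst z) \<oplus>\<^bsub>A\<^esub> \<tau> (snd z)"
  let ?n = "\<lambda>x. (u x, \<sigma> (x \<ominus>\<^bsub>A\<^esub> v (u x)))"
  have u\<tau>: "u (\<tau> z) = \<zero>\<^bsub>B\<^esub>" "\<tau> z \<in> carrier A" if "z \<in> carrier Q" for z
    using lhomD(1)[OF \<tau> that] by (auto simp: a_kernel_def')
  have q\<tau>: "q (\<tau> z) = \<zero>\<^bsub>M\<^esub>" if "z \<in> carrier Q" for z
    using pu[OF u\<tau>(2)[OF that]] u\<tau>(1)[OF that] lhom_zero[OF LB LM p] by simp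
  interpret M: left_module R M by (rule LM)
  have m: "?m \<in> lhom R (mod_sum ?S Q) ?W"
    unfolding ker_mod_def[of A M]
  proof (rule lhom_corestrict[OF mod_sum_copair[OF LA v' \<tau>']])
    fix z assume "z \<in> carrier (mod_sum ?S Q)"
    then have z: "fst z \<in> carrier B" "p (fst z) = \<zero>\<^bsub>M\<^esub>" "snd z \<in> carrier Q"
      by (auto simp: a_kernel_def')
    then show "?m z \<in> a_kernel A M q"
      using lhomD(1)[OF v] u\<tau>(2) q\<tau> qv by (simp add: a_kernel_def' lhomD(2)[OF q(1)])
  qed
  have n: "?n \<in> lhom R ?W (mod_sum ?S Q)"
  proof (rule mod_sum_pair)
    show "u \<in> lhom R ?W ?S"
      unfolding ker_mod_def
      by (intro lhom_corestrict lhom_restrict[OF u])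
        (auto simp: a_kernel_def' lhomD(1)[OF u] pu)
    have "(\<lambda>x. x \<ominus>\<^bsub>A\<^esub> v (u x)) \<in> lhom R ?W ?K"
      unfolding ker_mod_def[of A M] by (rule lhom_restrict[OF K(1)]) (auto simp: a_kernel_def')
    then show "(\<lambda>x. \<sigma> (x \<ominus>\<^bsub>A\<^esub> v (u x))) \<in> lhom R ?W Q"
      by (rule lhom_comp[OF _ \<sigma>])
  qed
  have nm: "?n (?m z) = z" if "z \<in> carrier (mod_sum ?S Q)" for z
  proof -
    have z: "fst z \<in> carrier B" "snd z \<in> carrier Q"
      using that by (auto simp: a_kernel_def')
    note [simp] = lhomD(1)[OF v z(1)] u\<tau>[OF z(2)]
    have "u (?m z) = fst z"
      using z by (simp add: lhomD(2)[OF u] uv)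
    then show ?thesis
      using z by (simp add: A.add_minus_cancel \<sigma>\<tau>)
  qed
  have mn: "?m (?n x) = x" if "x \<in> carrier ?W" for x
  proof -
    have x: "x \<in> carrier A"
      using that by (auto simp: a_kernel_def')
    show ?thesis
      using x \<tau>\<sigma>[OF lhomD(1)[OF K(1) x]] lhomD(1)[OF v lhomD(1)[OF u x]]
      by (simp add: A.add_minus_cancel)
  qed
  show ?thesis
    by (rule that[OF Q m n nm mn])
qed

lemma fg_ker_mod:
  assumes "noetherian_module R (regular R)"
    and "fg_module R M" "left_module R K" "f \<in> lhom R M K"
  shows "fg_module R (ker_mod M K f)"
  using assms ker_mod_left_module[of R M K f] a_kernel_submodule[of R M K f]
    fin_gen_imp_noetherian[of R M]
  unfolding fg_module_def ker_mod_def noetherian_module_def by blast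

text \<open>Stated for any exact P \<rightarrow> N \<rightarrow> C \<rightarrow> 0 with P
  projective, to be applied to N = \<nu>P. The module W of pairs (x, y) in A1 \<oplus> P with a1 x +
  t y = 0 is computed in two ways: projecting to y gives the maps of the sequence, and comparing
  presentations of \<Omega>(C) gives its decomposition.\<close>

lemma second_syzygy_sequence:
  fixes P :: "('a, 'p) module" and N :: "('a, 'n) module" and C :: "('a, 'c) module"
    and A0 :: "('a, 'a0) module" and A1 :: "('a, 'a1) module"
    and B0 :: "('a, 'b0) module" and B1 :: "('a, 'b1) module"
  assumes noeth: "noetherian_module R (regular R)"
    and P: "fg_module R P" "projective_module R P"
    and \<alpha>: "\<alpha> \<in> lhom R P N" and \<pi>: "\<pi> \<in> lhom R N C" "\<pi> ` carrier N = carrier C"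
    and exact: "\<alpha> ` carrier P = a_kernel N C \<pi>"
    and covA0: "projective_cover R A0 a0 N"
    and covA1: "projective_cover R A1 a1 (ker_mod A0 N a0)"
    and covB0: "projective_cover R B0 b0 C"
    and covB1: "projective_cover R B1 b1 (ker_mod B0 C b0)"
  shows "\<exists>(Q :: ('a, nat \<Rightarrow> 'a) module) f g. fg_module R Q \<and> projective_module R Q \<and>
    exact_in_mod R (ker_mod A1 (ker_mod A0 N a0) a1) f (mod_sum (ker_mod B1 (ker_mod B0 C b0) b1) Q) g
      P \<alpha> N \<pi> C"
proof -
  let ?KA = "ker_mod A0 N a0" and ?KB = "ker_mod B0 C b0"
  have A0: "fg_module R A0" "projective_module R A0" and N: "fg_module R N"
    and a0: "a0 \<in> lhom R A0 N" "a0 ` carrier A0 = carrier N"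
    using covA0 unfolding projective_cover_def by auto
  have A1: "fg_module R A1" "projective_module R A1" and KA: "fg_module R ?KA"
    and a1: "a1 \<in> lhom R A1 ?KA" "a1 ` carrier A1 = carrier ?KA"
    using covA1 unfolding projective_cover_def by auto
  have B0: "fg_module R B0" and C: "fg_module R C" and b0: "b0 \<in> lhom R B0 C"
    using covB0 unfolding projective_cover_def by auto
  have B1: "fg_module R B1" and KB: "fg_module R ?KB" and b1: "b1 \<in> lhom R B1 ?KB"
    using covB1 unfolding projective_cover_def by auto
  note LP = fg_moduleD(1)[OF P(1)] and LN = fg_moduleD(1)[OF N] and LC = fg_moduleD(1)[OF C]
    and LA0 = fg_moduleD(1)[OF A0(1)] and LA1 = fg_moduleD(1)[OF A1(1)] and LKA = fg_moduleD(1)[OF KA]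
    and LB0 = fg_moduleD(1)[OF B0] and LB1 = fg_moduleD(1)[OF B1] and LKB = fg_moduleD(1)[OF KB]
  interpret P: left_module R P by (rule LP)
  interpret N: left_module R N by (rule LN)
  interpret A0: left_module R A0 by (rule LA0)
  have a1': "a1 \<in> lhom R A1 A0"
    using lhom_sub_modD[OF a1(1)[unfolded ker_mod_def]] by (auto simp: a_kernel_def')
  have a0a1: "a0 (a1 x) = \<zero>\<^bsub>N\<^esub>" if "x \<in> carrier A1" for x
    using lhomD(1)[OF a1(1) that] by (simp add: a_kernel_def')
  define S where "S = a_kernel N C \<pi>"
  have S_iff: "x \<in> S \<longleftrightarrow> \<pi> x = \<zero>\<^bsub>C\<^esub>" if "x \<in> carrier N" for x
    using that by (simp add: S_def a_kernel_def')
  define L where "L = {x \<in> carrier A0. a0 x \<in> S}"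
  have L: "submodule L R A0"
    unfolding L_def S_def
    by (rule lhom_vimage_submodule[OF LA0 LN a0(1) a_kernel_submodule[OF LN LC \<pi>(1)]])
  note LL = sub_mod_left_module[OF LA0 L]
  have L_iff: "x \<in> L \<longleftrightarrow> \<pi> (a0 x) = \<zero>\<^bsub>C\<^esub>" if "x \<in> carrier A0" for x
    using that S_iff[OF lhomD(1)[OF a0(1) that]] by (simp add: L_def)

  obtain t where t: "t \<in> lhom R P A0" "\<And>y. y \<in> carrier P \<Longrightarrow> a0 (t y) = \<alpha> y"
    using projective_lift[OF P(2) fg_moduleD(2)[OF P(1)] LA0 LN a0 \<alpha>] by blast
  let ?G = "mod_sum A1 P"
  have G: "fg_module R ?G" "projective_module R ?G"
    by (intro mod_sum_fg mod_sum_projective A1 P)+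
  note LG = fg_moduleD(1)[OF G(1)]
  define h where "h = (\<lambda>z. a1 (fst z) \<oplus>\<^bsub>A0\<^esub> t (snd z))"
  have h: "h \<in> lhom R ?G A0"
    unfolding h_def by (rule mod_sum_copair[OF LA0 a1' t(1)])
  have a0h: "a0 (h z) = \<alpha> (snd z)" if "z \<in> carrier ?G" for z
    using that lhomD(1)[OF a1'] lhomD(1)[OF t(1)] lhomD(1)[OF \<alpha>]
    by (auto simp: h_def lhomD(2)[OF a0(1)] a0a1 t(2))
  \<comment> \<open>Finer than surjectivity onto L, because the component in P is prescribed: x - t
    y lies in the kernel of \<open>a0\<close>, which \<open>a1\<close> covers. The case x = 0 later
    gives exactness at P.\<close>
  have h_onto: "\<exists>z\<in>carrier ?G. snd z = y \<and> h z = x"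
    if x: "x \<in> carrier A0" and y: "y \<in> carrier P" "a0 x = \<alpha> y" for x y
  proof -
    note ty = lhomD(1)[OF t(1) y(1)]
    have "x \<ominus>\<^bsub>A0\<^esub> t y \<in> carrier ?KA"
      using x ty lhomD(1)[OF \<alpha> y(1)]
      by (simp add: a_kernel_def' lhom_minus[OF LA0 LN a0(1)] t(2)[OF y(1)] y(2) N.minus_self)
    then obtain w where w: "w \<in> carrier A1" "a1 w = x \<ominus>\<^bsub>A0\<^esub> t y"
      unfolding a1(2)[symmetric] by auto
    have "h (w, y) = x"
      using x ty by (simp add: h_def w(2) A0.add_minus_cancel)
    then show ?thesis
      using w(1) y(1) by (intro bexI[of _ "(w, y)"]) auto
  qed
  have hL: "h \<in> lhom R ?G (sub_mod A0 L)"
  proof (rule lhom_corestrict[OF h])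
    fix z assume z: "z \<in> carrier ?G"
    then have "a0 (h z) \<in> S"
      unfolding a0h[OF z] S_def exact[symmetric] by auto
    then show "h z \<in> L"
      using lhomD(1)[OF h z] by (simp add: L_def)
  qed
  have hL_onto: "h ` carrier ?G = carrier (sub_mod A0 L)"
  proof
    show "carrier (sub_mod A0 L) \<subseteq> h ` carrier ?G"
    proof
      fix x assume "x \<in> carrier (sub_mod A0 L)"
      then have x: "x \<in> carrier A0" "a0 x \<in> \<alpha> ` carrier P"
        unfolding exact S_def[symmetric] by (simp_all add: L_def)
      then obtain y where "y \<in> carrier P" "a0 x = \<alpha> y" by auto
      from h_onto[OF x(1) this] show "x \<in> h ` carrier ?G" by auto
    qed
  qed (use lhomD(1)[OF hL] in auto)

  \<comment> \<open>Comparison with the projective cover of C\<close>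
  have \<pi>a0: "(\<lambda>x. \<pi> (a0 x)) \<in> lhom R A0 C" "(\<lambda>x. \<pi> (a0 x)) ` carrier A0 = carrier C"
    using lhom_comp[OF a0(1) \<pi>(1)] a0(2) \<pi>(2) by (simp_all flip: image_image)
  obtain u v where u: "u \<in> lhom R A0 B0" and v: "v \<in> lhom R B0 A0"
    and uv: "\<And>x. x \<in> carrier B0 \<Longrightarrow> u (v x) = x"
    and b0u: "\<And>x. x \<in> carrier A0 \<Longrightarrow> b0 (u x) = \<pi> (a0 x)"
    and a0v: "\<And>x. x \<in> carrier B0 \<Longrightarrow> \<pi> (a0 (v x)) = b0 x"
    using projective_cover_retract[OF covB0 A0 \<pi>a0] by blast
  let ?Z = "ker_mod A0 B0 u"
  \<comment> \<open>The projection of A0 onto ker u along the copy v(B0) of B0.\<close>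
  define r where "r = (\<lambda>x. x \<ominus>\<^bsub>A0\<^esub> v (u x))"
  note Z = split_kernel_projective[OF A0 LB0 u v uv, folded r_def]
  note LZ = fg_moduleD(1)[OF Z(3)]
  have rZ: "r x = x" if "x \<in> a_kernel A0 B0 u" for x
    using Z(2)[OF _ that] by (simp add: r_def)
  have ZL: "a_kernel A0 B0 u \<subseteq> L"
    using lhom_zero[OF LB0 LC b0] by (auto simp: a_kernel_def' L_iff simp flip: b0u)
  \<comment> \<open>Z is projective and h maps onto L, so the inclusion of Z in L lifts to
    \<open>s\<close>. This section splits r h, and Z becomes a summand of A1 \<oplus> P.\<close>
  have "(\<lambda>x. x) \<in> lhom R ?Z (sub_mod A0 L)"
    unfolding ker_mod_def using ZL by (intro lhomI) auto
  then obtain s where s: "s \<in> lhom R ?Z ?G" "\<And>x. x \<in> carrier ?Z \<Longrightarrow> h (s x) = x"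
    using projective_lift[OF Z(4) fg_moduleD(2)[OF Z(3)] LG LL hL hL_onto] by blast
  let ?e = "\<lambda>z. r (h z)"
  have e: "?e \<in> lhom R ?G ?Z"
    by (rule lhom_comp[OF h Z(1)])
  have es: "?e (s x) = x" if "x \<in> carrier ?Z" for x
    using s(2)[OF that] rZ that by simp
  \<comment> \<open>The complement of Z in A1 \<oplus> P. On it h takes values in v(B0), since r h =
    0, and also in L; thus u h has values in the kernel of \<open>b0\<close>.\<close>
  let ?G' = "ker_mod ?G ?Z ?e"
  note G' = split_kernel_projective(3,4)[OF G LZ e s(1) es]
  have G'_iff: "z \<in> carrier ?G' \<longleftrightarrow> z \<in> carrier ?G \<and> r (h z) = \<zero>\<^bsub>A0\<^esub>" for z
    by (simp add: a_kernel_def')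
  let ?w = "\<lambda>z. u (h z)"
  have w: "?w \<in> lhom R ?G' ?KB"
    unfolding ker_mod_def
  proof (intro lhom_corestrict lhom_restrict lhom_comp[OF h u])
    fix z assume "z \<in> carrier (sub_mod ?G (a_kernel ?G (sub_mod A0 (a_kernel A0 B0 u)) ?e))"
    then have z: "z \<in> carrier ?G" by (simp add: a_kernel_def')
    then show "u (h z) \<in> a_kernel B0 C b0"
      using lhomD(1)[OF h z] lhomD(1)[OF u] lhomD(1)[OF hL z]
      by (simp add: a_kernel_def' b0u L_iff)
  qed (auto simp: a_kernel_def')
  have w_onto: "?w ` carrier ?G' = carrier ?KB"
  proof
    show "carrier ?KB \<subseteq> ?w ` carrier ?G'"
    proof
      fix y assume "y \<in> carrier ?KB"
      then have y: "y \<in> carrier B0" "b0 y = \<zero>\<^bsub>C\<^esub>" by (auto simp: a_kernel_def')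
      note vy = lhomD(1)[OF v y(1)]
      have "v y \<in> carrier (sub_mod A0 L)"
        using a0v[OF y(1)] y(2) by (simp add: L_iff[OF vy])
      then obtain z where z: "z \<in> carrier ?G" "h z = v y"
        unfolding hL_onto[symmetric] by auto
      have "r (h z) = \<zero>\<^bsub>A0\<^esub>"
        unfolding r_def z(2) uv[OF y(1)] by (rule A0.minus_self[OF vy])
      then have "z \<in> carrier ?G'"
        using z(1) G'_iff by blast
      moreover have "?w z = y"
        by (simp add: z(2) uv[OF y(1)])
      ultimately show "y \<in> ?w ` carrier ?G'" by blast
    qed
  qed (use lhomD(1)[OF w] in blast)
  \<comment> \<open>If u(h z) = 0, then h z lies in Z, where r is the identity; so r(h z) = 0 forces
    h z = 0. Hence discarding Z does not change the kernel of h.\<close>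
  have W: "a_kernel ?G' ?KB ?w = {z \<in> carrier ?G. h z = \<zero>\<^bsub>A0\<^esub>}"
  proof (intro equalityI subsetI)
    fix z assume "z \<in> a_kernel ?G' ?KB ?w"
    then have z: "z \<in> carrier ?G" "r (h z) = \<zero>\<^bsub>A0\<^esub>" "u (h z) = \<zero>\<^bsub>B0\<^esub>"
      using G'_iff[of z] unfolding a_kernel_def'[of ?G'] by auto
    then show "z \<in> {z \<in> carrier ?G. h z = \<zero>\<^bsub>A0\<^esub>}"
      using rZ[of "h z"] lhomD(1)[OF h z(1)] unfolding a_kernel_def'[of A0] by auto
  next
    fix z assume "z \<in> {z \<in> carrier ?G. h z = \<zero>\<^bsub>A0\<^esub>}"
    then have z: "z \<in> carrier ?G" "h z = \<zero>\<^bsub>A0\<^esub>" by auto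
    moreover have "r \<zero>\<^bsub>A0\<^esub> = \<zero>\<^bsub>A0\<^esub>" "u \<zero>\<^bsub>A0\<^esub> = \<zero>\<^bsub>B0\<^esub>"
      using lhom_zero[OF LA0 LZ Z(1)] lhom_zero[OF LA0 LB0 u] by simp_all
    ultimately show "z \<in> a_kernel ?G' ?KB ?w"
      using G'_iff[of z] unfolding a_kernel_def'[of ?G'] by simp
  qed
  let ?W = "ker_mod ?G' ?KB ?w" and ?KA1 = "ker_mod A1 ?KA a1" and ?KB1 = "ker_mod B1 ?KB b1"
  have W': "z \<in> carrier ?W \<longleftrightarrow> z \<in> carrier ?G \<and> h z = \<zero>\<^bsub>A0\<^esub>" for z
    using W by simp
  \<comment> \<open>Both B1 and G' are projective and map onto \<Omega>(C), the former minimally, so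
    the kernel W of the latter is \<Omega>^2(C) \<oplus> Q.\<close>
  obtain Q :: "('a, nat \<Rightarrow> 'a) module" and m n where Q: "fg_module R Q" "projective_module R Q"
    and m: "m \<in> lhom R (mod_sum ?KB1 Q) ?W" and n: "n \<in> lhom R ?W (mod_sum ?KB1 Q)"
    and nm: "\<And>x. x \<in> carrier (mod_sum ?KB1 Q) \<Longrightarrow> n (m x) = x"
    and mn: "\<And>x. x \<in> carrier ?W \<Longrightarrow> m (n x) = x"
    using kernel_of_projective_epi[OF covB1 G' w w_onto] by blast
  let ?i = "\<lambda>x. (x, \<zero>\<^bsub>P\<^esub>)"
  have t0: "t \<zero>\<^bsub>P\<^esub> = \<zero>\<^bsub>A0\<^esub>"
    by (rule lhom_zero[OF LP LA0 t(1)])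
  have W_G: "ring.add ?W = ring.add ?G" "module.smult ?W = module.smult ?G"
    by simp_all
  have i: "?i \<in> lhom R ?KA1 ?W"
  proof (rule lhomI)
    fix x assume "x \<in> carrier ?KA1"
    then show "?i x \<in> carrier ?W"
      unfolding W' by (simp add: a_kernel_def' h_def t0)
  qed (simp_all add: a_kernel_def')
  \<comment> \<open>A pair (x, 0) lies in W exactly when a1 x = 0: the kernel of W \<rightarrow> P
    is the second syzygy of N.\<close>
  have W_i: "z \<in> ?i ` carrier ?KA1" if z: "z \<in> carrier ?W" "snd z = \<zero>\<^bsub>P\<^esub>" for z
  proof -
    obtain x where "z = (x, \<zero>\<^bsub>P\<^esub>)" using z(2) by (cases z) auto
    moreover from this z(1) have "x \<in> carrier ?KA1"
      using lhomD(1)[OF a1', of x] unfolding W' by (auto simp: h_def t0 a_kernel_def')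
    ultimately show ?thesis by auto
  qed
  have snd_W: "snd \<in> lhom R ?W P"
    using mod_sum_lhom(2)[of R A1 P] unfolding lhom_def W_G using W' by auto
  \<comment> \<open>The inclusion of \<Omega>^2(N) into W and the projection of W to P, transported
    along the isomorphism of W with \<Omega>^2(C) \<oplus> Q.\<close>
  let ?f = "\<lambda>x. n (?i x)" and ?g = "\<lambda>x. snd (m x)"
  have f: "?f \<in> lhom R ?KA1 (mod_sum ?KB1 Q)"
    by (rule lhom_comp[OF i n])
  have g: "?g \<in> lhom R (mod_sum ?KB1 Q) P"
    by (rule lhom_comp[OF m snd_W])
  have inj: "inj_on ?f (carrier ?KA1)"
  proof (rule inj_onI)
    fix x y assume "x \<in> carrier ?KA1" "y \<in> carrier ?KA1" "?f x = ?f y"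
    then have "m (n (?i x)) = m (n (?i y))" and W: "?i x \<in> carrier ?W" "?i y \<in> carrier ?W"
      using lhomD(1)[OF i] by auto
    then show "x = y"
      unfolding mn[OF W(1)] mn[OF W(2)] by simp
  qed
  have ex1: "?f ` carrier ?KA1 = a_kernel (mod_sum ?KB1 Q) P ?g"
  proof
    show "?f ` carrier ?KA1 \<subseteq> a_kernel (mod_sum ?KB1 Q) P ?g"
    proof
      fix y assume "y \<in> ?f ` carrier ?KA1"
      then obtain x where x: "x \<in> carrier ?KA1" "y = ?f x" by blast
      then show "y \<in> a_kernel (mod_sum ?KB1 Q) P ?g"
        using lhomD(1)[OF f x(1)] mn[OF lhomD(1)[OF i x(1)]]
        unfolding a_kernel_def'[of "mod_sum ?KB1 Q"] by simp
    qed
    show "a_kernel (mod_sum ?KB1 Q) P ?g \<subseteq> ?f ` carrier ?KA1"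
    proof
      fix x assume "x \<in> a_kernel (mod_sum ?KB1 Q) P ?g"
      then have x: "x \<in> carrier (mod_sum ?KB1 Q)" "snd (m x) = \<zero>\<^bsub>P\<^esub>"
        unfolding a_kernel_def'[of "mod_sum ?KB1 Q"] by auto
      then have "m x \<in> ?i ` carrier ?KA1"
        using W_i lhomD(1)[OF m] by blast
      then obtain y where "y \<in> carrier ?KA1" "m x = ?i y" by blast
      then have "n (m x) \<in> ?f ` carrier ?KA1" by auto
      then show "x \<in> ?f ` carrier ?KA1" unfolding nm[OF x(1)] .
    qed
  qed
  have ex2: "?g ` carrier (mod_sum ?KB1 Q) = a_kernel P N \<alpha>"
  proof
    show "?g ` carrier (mod_sum ?KB1 Q) \<subseteq> a_kernel P N \<alpha>"
    proof
      fix y assume "y \<in> ?g ` carrier (mod_sum ?KB1 Q)"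
      then obtain z where "z \<in> carrier ?W" "y = snd z"
        using lhomD(1)[OF m] by blast
      then have z: "z \<in> carrier ?G" "h z = \<zero>\<^bsub>A0\<^esub>" "y = snd z"
        unfolding W' by auto
      then show "y \<in> a_kernel P N \<alpha>"
        using a0h[OF z(1)] lhom_zero[OF LA0 LN a0(1)] by (auto simp: a_kernel_def')
    qed
    show "a_kernel P N \<alpha> \<subseteq> ?g ` carrier (mod_sum ?KB1 Q)"
    proof
      fix y assume "y \<in> a_kernel P N \<alpha>"
      then have y: "y \<in> carrier P" "a0 \<zero>\<^bsub>A0\<^esub> = \<alpha> y"
        using lhom_zero[OF LA0 LN a0(1)] by (auto simp: a_kernel_def')
      from h_onto[OF A0.M.zero_closed this] obtain z where z: "z \<in> carrier ?W" "snd z = y"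
        unfolding W' by auto
      show "y \<in> ?g ` carrier (mod_sum ?KB1 Q)"
        using z mn[OF z(1)] lhomD(1)[OF n z(1)] by (intro image_eqI[of _ _ "n z"]) auto
    qed
  qed
  note fg_ker = fg_ker_mod[OF noeth]
  show ?thesis
    using Q P N C \<alpha> \<pi> exact f g inj ex1 ex2
      fg_ker[OF A1(1) LKA a1(1)] mod_sum_fg[OF fg_ker[OF B1 LKB b1] Q(1)]
    unfolding exact_in_mod_def by blast
qed

theorem corollary5p3:
  fixes k :: "'k ring" and \<Lambda> :: "('k, 'a) module"
    and E :: "('k, 'e) module" and j :: "'k set \<Rightarrow> 'e"
    and P :: "('a, 'p) module" and \<phi> :: "'p set \<Rightarrow> ('p \<Rightarrow> 'a) \<Rightarrow> 'e"
    and A0 :: "('a, 'a0) module" and A1 :: "('a, 'a1) module"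
    and B0 :: "('a, 'b0) module" and B1 :: "('a, 'b1) module"
  assumes "artin_algebra k \<Lambda>"
    and "injective_envelope k (top_mod k (regular k)) E j"
    and "fg_module \<Lambda> P" and "projective_module \<Lambda> P" and "indecomposable_module \<Lambda> P"
    and nuP: "\<nu>P = nakayama k E \<Lambda> P"
    and C: "C = quot_mod \<nu>P (soc \<Lambda> \<nu>P)"
    and "\<phi> \<in> liso \<Lambda> (top_mod \<Lambda> P) (sub_mod \<nu>P (soc \<Lambda> \<nu>P))"
    and "projective_cover \<Lambda> A0 a0 \<nu>P"
    and "projective_cover \<Lambda> A1 a1 (ker_mod A0 \<nu>P a0)"
    and "projective_cover \<Lambda> B0 b0 C"
    and "projective_cover \<Lambda> B1 b1 (ker_mod B0 C b0)"
  shows "\<exists>(Q :: ('a, nat \<Rightarrow> 'a) module) f g. fg_module \<Lambda> Q \<and> projective_module \<Lambda> Q \<and>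
    exact_in_mod \<Lambda>
      (ker_mod A1 (ker_mod A0 \<nu>P a0) a1) f
      (mod_sum (ker_mod B1 (ker_mod B0 C b0) b1) Q) g
      P (alpha_map \<Lambda> P \<phi>)
      \<nu>P (\<lambda>x. soc \<Lambda> \<nu>P +>\<^bsub>\<nu>P\<^esub> x)
      C"
proof -
  note cover = \<open>projective_cover \<Lambda> A0 a0 \<nu>P\<close> \<open>projective_cover \<Lambda> A1 a1 (ker_mod A0 \<nu>P a0)\<close>
    \<open>projective_cover \<Lambda> B0 b0 C\<close> \<open>projective_cover \<Lambda> B1 b1 (ker_mod B0 C b0)\<close>
  note P = \<open>fg_module \<Lambda> P\<close> \<open>projective_module \<Lambda> P\<close>
  \<comment> \<open>\<open>projective_cover\<close> includes that its target is a finitely generated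
    module, which here supplies the module laws of \<nu>P.\<close>
  have N: "left_module \<Lambda> \<nu>P"
    using cover(1) by (simp add: projective_cover_def fg_module_def)
  note soc = soc_submodule[OF N]
  note \<alpha> = alpha_map_lhom[OF fg_moduleD(1)[OF P(1)] N
      \<open>\<phi> \<in> liso \<Lambda> (top_mod \<Lambda> P) (sub_mod \<nu>P (soc \<Lambda> \<nu>P))\<close>]
  note \<pi> = quot_mod_proj[OF N soc, folded C]
  \<comment> \<open>Exactness at \<nu>P is the one remaining premise: the image of \<alpha> and the
    kernel of the projection to C are both the socle.\<close>
  show ?thesis
    using second_syzygy_sequence[OF artin_algebra_noetherian[OF \<open>artin_algebra k \<Lambda>\<close>] P \<alpha>(1)
        \<pi>(1,2) _ cover] \<alpha>(2) \<pi>(3) by simp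
qed

end
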